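(* Consider an edge $(i,j)$ of the network and its corresponding transfer function $G_{ji}^0$, and let $N_i^+$ be the set of out-neighbors of $i$. The transfer function $G_{ji}^0$ can be generically uniquely identified by measuring the nodes $\mathcal{C}$ if and only if $$ b_{N_i^+\to\mathcal{C}} = b_{N_i^+\setminus\{j\}\to\mathcal{C}} + 1. $$
   Context: Network. There are $L$ nodes with signals $w(t)=[w_1(t),\dots,w_L(t)]^T$ obeying $w(t)=G^0(q)w(t)+r(t)+v(t)$, where $q^{-1}$ is the delay operator, $r(t)$ is a vector of known external excitation signals (one at each node), $v(t)$ is a noise vector, and the network matrix $G^0$ is an $L\times L$ matrix with zero diagonal whose entries are proper rational transfer functions; the network is well-posed ($(I-G^0)^{-1}$ is proper and stable). $T^0=(I-G^0)^{-1}$. Topology. The topology is a known weakly connected directed graph on $\{1,\dots,L\}$ without self-loops; an edge $(j,i)$ from $j$ to $i$ corresponds to a transfer function $G_{ij}$ that is not known to be zero. A matrix $M$ is consistent with the graph if $M_{ij}\neq 0$ only if $(j,i)$ is an edge (an edge does not force $M_{ij}\ne0$). $G^0$ is consistent with its graph. $N_i^+$ is the set of nodes $j$ such that $(i,j)$ is an edge. Measurements. $y(t)=Cw(t)$, where $C$ is a $p\times L$ matrix each row of which has one entry $1$ and all others $0$; $\mathcal{C}$ is the set of $p$ nodes selected by $C$. The matrix $CT^0$ is assumed exactly known. Generic identifiability. A rational transfer matrix parametrization consistent with the graph: for every edge $(j,i)$ fix nonnegative integers $p_{ij},n_{ij}$ and set $$G_{ij}(z)=\kappa_{ij}z^{-p_{ij}}\frac{z^{n_{ij}}+\beta_{ij}^{(n_{ij}-1)}z^{n_{ij}-1}+\dots+\beta_{ij}^{(0)}}{z^{n_{ij}}+\alpha_{ij}^{(n_{ij}-1)}z^{n_{ij}-1}+\dots+\alpha_{ij}^{(0)}}$$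 with real parameters $\kappa_{ij},\alpha_{ij}^{(m)},\beta_{ij}^{(m)}$, and $G_{ij}(z)=0$ when $(j,i)$ is not an edge. All parameters are collected in $P\in\mathbb{R}^N$, and the resulting matrix is $G(P,z)$. The transfer function $G^0_{ji}$ of edge $(i,j)$ is generically identifiable by measuring $\mathcal{C}$ (from $CT^0$) if for every such parametrization, for all $P$ except possibly those in a zero-measure subset of $\mathbb{R}^N$, the following holds: for every network matrix $\tilde G(z)$ consistent with the graph, $C(I-G(P,z))^{-1}=C(I-\tilde G(z))^{-1}$ implies $G_{ji}(P,z)=\tilde G_{ji}(z)$. Paths. A walk is a sequence of adjacent directed edges (including trivial walks consisting of one node and no edge). A path is a walk that never passes twice through the same node. Paths are mutually vertex disjoint if no two of them contain a common vertex (including start and end vertices). For sets of nodes $\mathcal{A},\mathcal{C}$, $b_{\mathcal{A}\to\mathcal{C}}$ is the maximum number of mutually vertex disjoint paths starting in $\mathcal{A}$ and ending in $\mathcal{C}$. *)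

theory Defs
  imports
    "HOL-Analysis.Analysis"
    "HOL-Computational_Algebra.Fraction_Field"
begin

section \<open>Rational transfer functions\<close>

text \<open>
  Transfer functions are rational functions in \<open>z\<close> with real coefficients. Time is discrete, so
  stability means that all poles lie strictly inside the unit disc. Both predicates below ask for
  \<^emph>\<open>some\<close> representation as a fraction: cancelling common factors changes numerator and denominator
  degrees by the same amount and only removes roots of the denominator, so this agrees with the
  condition on the reduced fraction.
\<close>

type_synonym transfer = "real poly fract"

definition proper :: "transfer \<Rightarrow> bool" where
  "proper f \<longleftrightarrow> (\<exists>a b. b \<noteq> 0 \<and> f = Fract a b \<and> degree a \<le> degree b)"

definition stable :: "transfer \<Rightarrow> bool" where
  "stable f \<longleftrightarrow> (\<exists>a b. b \<noteq> 0 \<and> f = Fract a b \<and>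
     (\<forall>z::complex. poly (map_poly complex_of_real b) z = 0 \<longrightarrow> norm z < 1))"


section \<open>Networks\<close>

definition well_posed :: "transfer^'n^'n \<Rightarrow> bool" where
  "well_posed G \<longleftrightarrow> invertible (mat 1 - G) \<and>
     (\<forall>i j. proper (matrix_inv (mat 1 - G) $ i $ j) \<and> stable (matrix_inv (mat 1 - G) $ i $ j))"

definition network_matrix :: "transfer^'n^'n \<Rightarrow> bool" where
  "network_matrix G \<longleftrightarrow> (\<forall>i. G $ i $ i = 0) \<and> (\<forall>i j. proper (G $ i $ j)) \<and> well_posed G"

text \<open>
  A topology is a set \<open>E\<close> of edges, \<open>(j, i) \<in> E\<close> being an edge from \<open>j\<close> to \<open>i\<close>. Note the index
  reversal: that edge carries the matrix entry in row \<open>i\<close> and column \<open>j\<close>.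
\<close>

definition weakly_connected :: "('n \<times> 'n) set \<Rightarrow> bool" where
  "weakly_connected E \<longleftrightarrow> (E \<union> E\<inverse>)\<^sup>* = UNIV"

definition consistent :: "('n \<times> 'n) set \<Rightarrow> ('a::zero)^'n^'n \<Rightarrow> bool" where
  "consistent E M \<longleftrightarrow> (\<forall>i j. M $ i $ j \<noteq> 0 \<longrightarrow> (j, i) \<in> E)"

definition measured_nodes :: "('a::{zero,one})^'n^'p \<Rightarrow> 'n set" where
  "measured_nodes C = {k. \<exists>r. C $ r $ k = 1}"

text \<open>The cardinality condition says that different rows select different nodes.\<close>

definition selection_matrix :: "('a::{zero,one})^'n^'p \<Rightarrow> bool" where
  "selection_matrix C \<longleftrightarrow> (\<forall>r. \<exists>k. C $ r = axis k 1) \<and> card (measured_nodes C) = CARD('p)"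


section \<open>Rational parametrizations and generic identifiability\<close>

text \<open>
  Parameters are named by the matrix entry they belong to and, for \<open>\<alpha>\<close> and \<open>\<beta>\<close>, by the power of
  \<open>z\<close> they multiply. A parameter vector \<open>P \<in> \<real>\<^sup>N\<close> is a function on the finite set \<open>parameters E n\<close>
  of names, of cardinality \<open>N\<close>, and the measure on \<open>\<real>\<^sup>N\<close> is the product of \<open>N\<close> copies of \<^term>\<open>lborel\<close>.
\<close>

datatype 'n parameter = Kappa 'n 'n | Alpha 'n 'n nat | Beta 'n 'n nat

definition parameters :: "('n \<times> 'n) set \<Rightarrow> ('n \<Rightarrow> 'n \<Rightarrow> nat) \<Rightarrow> 'n parameter set" where
  "parameters E n =
     {Kappa i j | i j. (j, i) \<in> E} \<union>
     {Alpha i j m | i j m. (j, i) \<in> E \<and> m < n i j} \<union>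
     {Beta i j m | i j m. (j, i) \<in> E \<and> m < n i j}"

definition monic_poly :: "nat \<Rightarrow> (nat \<Rightarrow> real) \<Rightarrow> real poly" where
  "monic_poly d c = monom 1 d + (\<Sum>m<d. monom (c m) m)"

definition parametrized_matrix ::
  "('n \<times> 'n) set \<Rightarrow> ('n \<Rightarrow> 'n \<Rightarrow> nat) \<Rightarrow> ('n \<Rightarrow> 'n \<Rightarrow> nat) \<Rightarrow> ('n parameter \<Rightarrow> real) \<Rightarrow> transfer^'n^'n"
where
  "parametrized_matrix E p n P = (\<chi> i j.
     if (j, i) \<in> E then
       Fract (smult (P (Kappa i j)) (monic_poly (n i j) (\<lambda>m. P (Beta i j m))))
             (monom 1 (p i j) * monic_poly (n i j) (\<lambda>m. P (Alpha i j m)))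
     else 0)"

text \<open>
  The edge under consideration is \<open>(i, j)\<close>, so the identified entry is in row \<open>j\<close> and column \<open>i\<close>.
\<close>

definition generically_identifiable ::
  "('n::finite \<times> 'n) set \<Rightarrow> transfer^'n^'p \<Rightarrow> 'n \<Rightarrow> 'n \<Rightarrow> bool"
where
  "generically_identifiable E C i j \<longleftrightarrow>
     (\<forall>p n. AE P in Pi\<^sub>M (parameters E n) (\<lambda>_. lborel).
        \<forall>G'. network_matrix G' \<longrightarrow> consistent E G' \<longrightarrow>
          C ** matrix_inv (mat 1 - parametrized_matrix E p n P) = C ** matrix_inv (mat 1 - G') \<longrightarrow>
          parametrized_matrix E p n P $ j $ i = G' $ j $ i)"


section \<open>Vertex disjoint paths\<close>

definition is_walk :: "('n \<times> 'n) set \<Rightarrow> 'n list \<Rightarrow> bool" where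
  "is_walk E ps \<longleftrightarrow> ps \<noteq> [] \<and> successively (\<lambda>u v. (u, v) \<in> E) ps"

definition is_path :: "('n \<times> 'n) set \<Rightarrow> 'n list \<Rightarrow> bool" where
  "is_path E ps \<longleftrightarrow> is_walk E ps \<and> distinct ps"

definition disjoint_path_family :: "('n \<times> 'n) set \<Rightarrow> 'n set \<Rightarrow> 'n set \<Rightarrow> 'n list set \<Rightarrow> bool" where
  "disjoint_path_family E A B S \<longleftrightarrow>
     (\<forall>ps\<in>S. is_path E ps \<and> hd ps \<in> A \<and> last ps \<in> B) \<and>
     pairwise (\<lambda>ps qs. disjnt (set ps) (set qs)) S"

definition max_disjoint_paths :: "('n::finite \<times> 'n) set \<Rightarrow> 'n set \<Rightarrow> 'n set \<Rightarrow> nat" where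
  "max_disjoint_paths E A B = Max {card S | S. disjoint_path_family E A B S}"

end

theory Submission imports Defs begin

text \<open>
  If \<open>C (I - G)\<^sup>-\<^sup>1 = C (I - G')\<^sup>-\<^sup>1\<close>, then the \<open>i\<close>-th column of \<open>G' - G\<close> is an excitation supported on the
  out-neighbours of \<open>i\<close> that is invisible at the measured nodes. So \<open>G\<^sub>j\<^sub>i\<close> is determined iff column \<open>j\<close>
  of \<open>C (I - G)\<^sup>-\<^sup>1\<close> is independent of the columns of the other out-neighbours, that is, iff the
  rank of the columns drops when \<open>j\<close> is removed. The rank of the columns \<open>A\<close> is at most the number of
  disjoint paths from \<open>A\<close> to the measured nodes for every consistent \<open>G\<close>, and equal to it for almost
  all parameters. The upper bound does not need Menger's theorem: an invertible matrix has a nonzero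
  term in its Leibniz expansion, and the permutation in that term traces out the paths. Conversely,
  if the rank does not drop, a parametrization with small gains and pure delays leaves room for a
  proper and stable perturbation of column \<open>i\<close>.
\<close>

section \<open>Zero sets of polynomial functions\<close>

text \<open>Polynomial in each coordinate separately, plus measurability, is all that an induction
  over the coordinates by Fubini needs.\<close>

definition polynomial_on :: "'i set \<Rightarrow> (('i \<Rightarrow> real) \<Rightarrow> real) \<Rightarrow> bool" where
  "polynomial_on I h \<longleftrightarrow> h \<in> borel_measurable (Pi\<^sub>M I (\<lambda>_. lborel)) \<and>
     (\<forall>P x. \<exists>q. \<forall>t. h (P(x := t)) = poly q t)"

lemma polynomial_onI:
  assumes "h \<in> borel_measurable (Pi\<^sub>M I (\<lambda>_. lborel))"
    and "\<And>P x. \<exists>q. \<forall>t. h (P(x := t)) = poly q t"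
  shows "polynomial_on I h"
  using assms by (auto simp: polynomial_on_def)

lemma polynomial_onD:
  assumes "polynomial_on I h"
  shows "h \<in> borel_measurable (Pi\<^sub>M I (\<lambda>_. lborel))"
    and "\<exists>q. \<forall>t. h (P(x := t)) = poly q t"
  using assms by (auto simp: polynomial_on_def)

lemma polynomial_on_const: "polynomial_on I (\<lambda>_. c)"
  by (rule polynomial_onI) (auto intro: exI[of _ "[:c:]"])

lemma polynomial_on_coord:
  assumes "y \<in> I"
  shows "polynomial_on I (\<lambda>P. P y)"
proof (rule polynomial_onI)
  show "(\<lambda>P. P y) \<in> borel_measurable (Pi\<^sub>M I (\<lambda>_. lborel))"
    using measurable_component_singleton[OF assms, of "\<lambda>_. lborel"] by simp
  show "\<exists>q. \<forall>t. (P(x := t)) y = poly q t" for P :: "'a \<Rightarrow> real" and x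
    by (cases "x = y") (auto intro: exI[of _ "[:0, 1:]"] exI[of _ "[:P y:]"])
qed

lemma polynomial_on_add:
  assumes "polynomial_on I f" "polynomial_on I g"
  shows "polynomial_on I (\<lambda>P. f P + g P)"
proof (rule polynomial_onI)
  show "(\<lambda>P. f P + g P) \<in> borel_measurable (Pi\<^sub>M I (\<lambda>_. lborel))"
    using assms[THEN polynomial_onD(1)] by simp
  fix P x
  obtain q r where "\<forall>t. f (P(x := t)) = poly q t" "\<forall>t. g (P(x := t)) = poly r t"
    using assms[THEN polynomial_onD(2)] by metis
  then show "\<exists>q. \<forall>t. f (P(x := t)) + g (P(x := t)) = poly q t"
    by (intro exI[of _ "q + r"]) simp
qed

lemma polynomial_on_mult:
  assumes "polynomial_on I f" "polynomial_on I g"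
  shows "polynomial_on I (\<lambda>P. f P * g P)"
proof (rule polynomial_onI)
  show "(\<lambda>P. f P * g P) \<in> borel_measurable (Pi\<^sub>M I (\<lambda>_. lborel))"
    using assms[THEN polynomial_onD(1)] by simp
  fix P x
  obtain q r where "\<forall>t. f (P(x := t)) = poly q t" "\<forall>t. g (P(x := t)) = poly r t"
    using assms[THEN polynomial_onD(2)] by metis
  then show "\<exists>q. \<forall>t. f (P(x := t)) * g (P(x := t)) = poly q t"
    by (intro exI[of _ "q * r"]) simp
qed

lemma polynomial_on_diff:
  assumes "polynomial_on I f" "polynomial_on I g"
  shows "polynomial_on I (\<lambda>P. f P - g P)"
  using polynomial_on_add[OF assms(1) polynomial_on_mult[OF polynomial_on_const[of _ "- 1"] assms(2)]]
  by simp

lemma polynomial_on_sum: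
  "(\<And>a. a \<in> A \<Longrightarrow> polynomial_on I (f a)) \<Longrightarrow> polynomial_on I (\<lambda>P. \<Sum>a\<in>A. f a P)"
  by (induction A rule: infinite_finite_induct)
    (simp_all add: polynomial_on_const polynomial_on_add)

lemma polynomial_on_prod:
  "(\<And>a. a \<in> A \<Longrightarrow> polynomial_on I (f a)) \<Longrightarrow> polynomial_on I (\<lambda>P. \<Prod>a\<in>A. f a P)"
  by (induction A rule: infinite_finite_induct)
    (simp_all add: polynomial_on_const polynomial_on_mult)

lemma polynomial_on_det:
  assumes "\<And>i j. polynomial_on I (\<lambda>P. A P $ i $ j)"
  shows "polynomial_on I (\<lambda>P. det (A P))"
  unfolding det_def
  by (intro polynomial_on_sum polynomial_on_mult polynomial_on_const polynomial_on_prod assms)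

text \<open>Fubini, one coordinate at a time: with \<open>x\<close> frozen at \<open>P0 x\<close>,
  the function is nonzero for almost all other coordinates by induction, and over each such point
  \<open>h\<close> is a nonzero polynomial in \<open>x\<close>, with finitely many roots.\<close>

lemma AE_polynomial_nonzero:
  assumes "finite I" "polynomial_on I h" "P0 \<in> extensional I" "h P0 \<noteq> 0"
  shows "AE P in Pi\<^sub>M I (\<lambda>_. lborel). h P \<noteq> 0"
  using assms
proof (induction I arbitrary: h P0 rule: finite_induct)
  case empty
  then show ?case
    by (auto simp: space_PiM intro!: AE_I2)
next
  case (insert x I)
  interpret product_sigma_finite "\<lambda>_ :: 'a. lborel :: real measure" ..
  note [measurable] = polynomial_onD(1)[OF insert.prems(1)]
  let ?M = "Pi\<^sub>M I (\<lambda>_. lborel :: real measure)"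
  let ?M' = "Pi\<^sub>M (insert x I) (\<lambda>_. lborel :: real measure)"
  define g where "g P = h (P(x := P0 x))" for P
  have "(\<lambda>P. (P, P0 x)) \<in> measurable ?M (?M \<Otimes>\<^sub>M lborel)"
    by measurable
  from measurable_comp[OF this measurable_add_dim]
  have upd: "(\<lambda>P. P(x := P0 x)) \<in> measurable ?M ?M'"
    by (simp add: o_def)
  have "polynomial_on I g"
  proof (rule polynomial_onI)
    show "g \<in> borel_measurable ?M"
      unfolding g_def using upd by measurable
    fix P y
    show "\<exists>q. \<forall>t. g (P(y := t)) = poly q t"
    proof (cases "x = y")
      case True
      then show ?thesis
        by (intro exI[of _ "[:g P:]"]) (simp add: g_def)
    next
      case False
      then show ?thesis
        using polynomial_onD(2)[OF insert.prems(1), of "P(x := P0 x)" y]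
        by (simp only: g_def fun_upd_twist[OF False[symmetric]])
    qed
  qed
  moreover have "(restrict P0 I)(x := P0 x) = P0"
    using insert.prems(2) by (auto simp: fun_eq_iff extensional_def)
  then have "g (restrict P0 I) \<noteq> 0"
    using insert.prems(3) by (simp only: g_def) simp
  ultimately have "AE P in ?M. g P \<noteq> 0"
    by (intro insert.IH[of g "restrict P0 I"] restrict_extensional)
  moreover have "(\<integral>\<^sup>+ t. indicator {Q \<in> space ?M'. h Q = 0} (P(x := t)) \<partial>lborel) = 0"
    if gP: "g P \<noteq> 0" for P
  proof -
    obtain q where q: "\<And>t. h (P(x := t)) = poly q t"
      using polynomial_onD(2)[OF insert.prems(1), of P x] by blast
    have "poly q (P0 x) \<noteq> 0"
      using gP q by (simp add: g_def)
    then have "q \<noteq> 0" by auto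
    then have "finite {t. poly q t = 0}"
      by (rule poly_roots_finite)
    then have "{t. poly q t = 0} \<in> null_sets lborel"
      by (rule finite_imp_null_set_lborel)
    then have "AE t in lborel. t \<notin> {t. poly q t = 0}"
      by (rule AE_not_in)
    then have "AE t in lborel. indicator {Q \<in> space ?M'. h Q = 0} (P(x := t)) = (0 :: ennreal)"
      by eventually_elim (auto simp: q indicator_def)
    then show ?thesis
      by (subst nn_integral_cong_AE[of _ "\<lambda>_. 0"]) auto
  qed
  ultimately have "AE P in ?M. (\<integral>\<^sup>+ t. indicator {Q \<in> space ?M'. h Q = 0} (P(x := t)) \<partial>lborel) = 0"
    by (auto elim!: eventually_mono)
  then have "(\<integral>\<^sup>+ P. (\<integral>\<^sup>+ t. indicator {Q \<in> space ?M'. h Q = 0} (P(x := t)) \<partial>lborel) \<partial>?M) = 0"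
    by (subst nn_integral_cong_AE[of _ "\<lambda>_. 0"]) auto
  moreover have "(\<lambda>P. indicator {Q \<in> space ?M'. h Q = 0} P :: ennreal) \<in> borel_measurable ?M'"
    by measurable
  ultimately have "(\<integral>\<^sup>+ P. indicator {Q \<in> space ?M'. h Q = 0} P \<partial>?M') = 0"
    using product_nn_integral_insert[OF insert.hyps, of "indicator {Q \<in> space ?M'. h Q = 0}"] by simp
  then have "emeasure ?M' {Q \<in> space ?M'. h Q = 0} = 0"
    by (subst (asm) nn_integral_indicator) auto
  then show ?case
    by (subst AE_iff_measurable[OF _ refl]) auto
qed

section \<open>Disjoint paths\<close>

text \<open>A path repeats no node, so there are finitely many paths and \<open>Max\<close> is over
  a finite set; \<open>S\<close> witnesses that it is nonempty.\<close>

lemma card_le_max_disjoint_paths: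
  fixes E :: "('n::finite \<times> 'n) set"
  assumes "disjoint_path_family E A B S"
  shows "card S \<le> max_disjoint_paths E A B"
    and "\<exists>S. disjoint_path_family E A B S \<and> card S = max_disjoint_paths E A B"
proof -
  let ?K = "{card S | S. disjoint_path_family E A B S}"
  have "?K \<subseteq> card ` Pow {ps :: 'n list. set ps \<subseteq> UNIV \<and> distinct ps}"
    by (auto simp: disjoint_path_family_def is_path_def)
  then have fin: "finite ?K"
    by (rule finite_subset) (intro finite_imageI finite_Pow_iff[THEN iffD2] finite_subset_distinct finite)
  then show "card S \<le> max_disjoint_paths E A B"
    unfolding max_disjoint_paths_def using assms by (intro Max_ge) auto
  show "\<exists>S. disjoint_path_family E A B S \<and> card S = max_disjoint_paths E A B"
    using Max_in[OF fin] assms unfolding max_disjoint_paths_def by fastforce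
qed

lemma ex_max_disjoint_path_family:
  obtains S where "disjoint_path_family E A B S" "card S = max_disjoint_paths E A B"
  using card_le_max_disjoint_paths(2)[of E A B "{}"] by (auto simp: disjoint_path_family_def)

lemma disjoint_path_familyD:
  assumes "disjoint_path_family E A B S" "ps \<in> S"
  shows "ps \<noteq> []" "distinct ps" "hd ps \<in> A" "last ps \<in> B"
    and "\<And>t. Suc t < length ps \<Longrightarrow> (ps ! t, ps ! Suc t) \<in> E"
    and "\<And>qs v. qs \<in> S \<Longrightarrow> v \<in> set ps \<Longrightarrow> v \<in> set qs \<Longrightarrow> ps = qs"
proof -
  show "ps \<noteq> []" "distinct ps" "hd ps \<in> A" "last ps \<in> B"
    using assms by (auto simp: disjoint_path_family_def is_path_def is_walk_def)
  show "(ps ! t, ps ! Suc t) \<in> E" if "Suc t < length ps" for t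
    using assms that
    by (auto simp: disjoint_path_family_def is_path_def is_walk_def successively_conv_nth)
  show "ps = qs" if "qs \<in> S" "v \<in> set ps" "v \<in> set qs" for qs v
    using assms that by (auto simp: disjoint_path_family_def pairwise_def disjnt_iff)
qed

lemma inj_on_hd_disjoint_path_family:
  assumes "disjoint_path_family E A B S"
  shows "inj_on hd S"
  using disjoint_path_familyD[OF assms] by (metis hd_in_set inj_onI)

lemma inj_on_last_disjoint_path_family:
  assumes "disjoint_path_family E A B S"
  shows "inj_on last S"
  using disjoint_path_familyD[OF assms] by (metis last_in_set inj_onI)

text \<open>Disjoint paths have distinct starts, so dropping at most one path of a maximum family
  leaves a family from \<open>A - {j}\<close>.\<close>

lemma max_disjoint_paths_le_remove:
  fixes E :: "('n::finite \<times> 'n) set"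
  shows "max_disjoint_paths E A B \<le> max_disjoint_paths E (A - {j}) B + 1"
proof -
  obtain S where S: "disjoint_path_family E A B S" "card S = max_disjoint_paths E A B"
    by (rule ex_max_disjoint_path_family)
  let ?S = "{ps \<in> S. hd ps \<noteq> j}"
  have "disjoint_path_family E (A - {j}) B ?S"
    using S(1) by (auto simp: disjoint_path_family_def pairwise_def)
  then have "card ?S \<le> max_disjoint_paths E (A - {j}) B"
    by (rule card_le_max_disjoint_paths)
  have inj: "inj_on hd S"
    by (rule inj_on_hd_disjoint_path_family[OF S(1)])
  then have "finite S"
    by (metis finite finite_imageD)
  have "card S = card (hd ` S)"
    by (simp add: card_image inj)
  also have "\<dots> \<le> card (insert j (hd ` ?S))"
    by (rule card_mono) auto
  also have "\<dots> \<le> card ?S + 1"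
    using card_image_le[of ?S hd] \<open>finite S\<close>
    by (simp add: card_insert_if)
  finally show ?thesis
    using S(2) \<open>card ?S \<le> _\<close> by simp
qed

text \<open>
  Since no point of \<open>A\<close> is a value of \<open>\<tau>\<close>, the orbits of \<open>\<tau>\<close> that start in \<open>A\<close> cannot cycle before
  they reach \<open>B\<close>, and cannot merge.
\<close>

lemma disjoint_path_family_of_injection:
  fixes E :: "('n::finite \<times> 'n) set"
  assumes inj: "inj_on \<tau> (- B)"
    and A: "\<And>k. k \<notin> B \<Longrightarrow> \<tau> k \<notin> A"
    and step: "\<And>k. k \<notin> B \<Longrightarrow> \<tau> k = k \<or> (k, \<tau> k) \<in> E"
  shows "\<exists>S. disjoint_path_family E A B S \<and> card S = card A"
proof -
  \<comment> \<open>Injectivity outside \<open>B\<close> pulls the common point back one step along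
    both orbits, until the shorter one is at its start \<open>a\<close>. As \<open>\<tau>\<close>
    maps no point outside \<open>B\<close> to \<open>a\<close>, the other orbit is at its start
    too.\<close>
  have meet: "a = b \<and> s = t"
    if "a \<in> A" "b \<in> A" "s \<le> t" "(\<tau> ^^ s) a = (\<tau> ^^ t) b"
      "\<forall>r<s. (\<tau> ^^ r) a \<notin> B" "\<forall>r<t. (\<tau> ^^ r) b \<notin> B" for a b s t
    using that
  proof (induction s arbitrary: t)
    case 0
    then show ?case
      by (cases t) (auto dest: A)
  next
    case (Suc s)
    then obtain t' where t: "t = Suc t'"
      by (cases t) auto
    have "(\<tau> ^^ s) a = (\<tau> ^^ t') b"
      using Suc.prems inj by (auto simp: t inj_on_def)
    then show ?case
      using Suc.IH[of t'] Suc.prems t by auto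
  qed
  have meet': "a = b \<and> s = t"
    if "a \<in> A" "b \<in> A" "(\<tau> ^^ s) a = (\<tau> ^^ t) b"
      "\<forall>r<s. (\<tau> ^^ r) a \<notin> B" "\<forall>r<t. (\<tau> ^^ r) b \<notin> B" for a b s t
    using meet[of a b s t] meet[of b a t s] that by (metis nle_le)
  have hit: "\<exists>t. (\<tau> ^^ t) a \<in> B" if "a \<in> A" for a
  proof (rule ccontr)
    assume "\<not> ?thesis"
    then have "inj (\<lambda>t. (\<tau> ^^ t) a)"
      using meet'[OF that that] by (auto simp: inj_def)
    then show False
      by (metis finite finite_imageD infinite_UNIV_nat)
  qed
  define m where "m a = (LEAST t. (\<tau> ^^ t) a \<in> B)" for a
  define path where "path a = map (\<lambda>t. (\<tau> ^^ t) a) [0..<Suc (m a)]" for a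
  have mB: "(\<tau> ^^ m a) a \<in> B" if "a \<in> A" for a
    unfolding m_def using hit[OF that] by (rule LeastI_ex)
  have mless: "(\<tau> ^^ t) a \<notin> B" if "t < m a" for a t
    using not_less_Least that unfolding m_def by blast
  have len: "length (path a) = Suc (m a)" for a
    by (simp add: path_def)
  have nth: "path a ! t = (\<tau> ^^ t) a" if "t \<le> m a" for a t
    using that nth_map_upt[of t "Suc (m a)" 0 "\<lambda>t. (\<tau> ^^ t) a"] unfolding path_def by simp
  have set: "set (path a) = (\<lambda>t. (\<tau> ^^ t) a) ` {..m a}" for a
    unfolding path_def by (simp add: atLeastLessThanSuc_atLeastAtMost atLeast0AtMost del: upt_Suc)
  have ne: "path a \<noteq> []" for a
    using len[of a] by auto
  have hd: "hd (path a) = a" for a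
    using nth[of 0 a] by (simp add: hd_conv_nth ne)
  have disj: "a = b \<and> s = t" if "a \<in> A" "b \<in> A" "s \<le> m a" "t \<le> m b" "(\<tau> ^^ s) a = (\<tau> ^^ t) b"
    for a b s t
    using meet'[of a b s t] that mless by (meson order_less_le_trans)
  have "disjoint_path_family E A B (path ` A)"
    unfolding disjoint_path_family_def
  proof (intro conjI ballI)
    show "pairwise (\<lambda>ps qs. disjnt (set ps) (set qs)) (path ` A)"
      using disj unfolding pairwise_def disjnt_iff by (auto simp: set)
    fix ps assume "ps \<in> path ` A"
    then obtain a where a: "a \<in> A" "ps = path a" by auto
    show "hd ps \<in> A" using a hd by simp
    show "last ps \<in> B"
      using a mB[of a] nth[of "m a" a] len[of a] by (simp add: last_conv_nth ne)
    have "distinct ps"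
      unfolding a(2) path_def distinct_map
      using disj[OF a(1) a(1)] by (intro conjI inj_onI distinct_upt) (simp add: less_Suc_eq_le del: upt_Suc)
    moreover have "(ps ! t, ps ! Suc t) \<in> E" if t: "Suc t < length ps" for t
    proof -
      have "t < m a" using t a len by simp
      \<comment> \<open>The orbit points up to time \<open>m a\<close> are distinct, which excludes
        the fixed-point alternative in \<open>step\<close> and leaves an edge.\<close>
      then have "(\<tau> ^^ Suc t) a \<noteq> (\<tau> ^^ t) a"
        using disj[OF a(1) a(1), of "Suc t" t] by auto
      then show ?thesis
        using step[OF mless[OF \<open>t < m a\<close>]] \<open>t < m a\<close> by (simp add: nth a)
    qed
    ultimately show "is_path E ps"
      by (simp add: is_path_def is_walk_def successively_conv_nth a ne)
  qed
  moreover have "card (path ` A) = card A"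
    by (intro card_image) (metis hd inj_onI)
  ultimately show ?thesis by blast
qed

section \<open>Observability\<close>

lemma matrix_vector_mult_lincomb:
  fixes A :: "'a::field^'n^'m"
  shows "A *v (\<Sum>k\<in>K. c k *s f k) = (\<Sum>k\<in>K. c k *s (A *v f k))"
  by (simp add: vec.linear_sum[OF matrix_vector_mul_linear_gen]
      vec.linear_scale[OF matrix_vector_mul_linear_gen])

text \<open>
  An excitation supported on \<open>A\<close> produces the node signals \<open>y\<close> with \<open>(I - G) y\<close> supported on \<open>A\<close>;
  the columns of \<open>C (I - G)\<^sup>-\<^sup>1\<close> belonging to \<open>A\<close> are linearly independent iff no such \<open>y \<noteq> 0\<close>
  vanishes on the measured nodes \<open>B\<close>. This formulation makes sense even if \<open>I - G\<close> is singular.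
\<close>

definition observable :: "'a::field^'n^'n \<Rightarrow> 'n set \<Rightarrow> 'n set \<Rightarrow> bool" where
  "observable G A B \<longleftrightarrow>
     (\<forall>y. (\<forall>k\<in>B. y $ k = 0) \<and> (\<forall>k. k \<notin> A \<longrightarrow> ((mat 1 - G) *v y) $ k = 0) \<longrightarrow> y = 0)"

lemma observableD:
  assumes "observable G A B" "\<And>k. k \<in> B \<Longrightarrow> y $ k = 0"
    and "\<And>k. k \<notin> A \<Longrightarrow> ((mat 1 - G) *v y) $ k = 0"
  shows "y = 0"
  using assms unfolding observable_def by blast

lemma observable_mono:
  assumes "observable G A B" "A' \<subseteq> A"
  shows "observable G A' B"
  using assms unfolding observable_def by (meson subsetD)

text \<open>Steinitz exchange: \<open>y\<close> expresses column \<open>j\<close> through the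
  columns of \<open>N - {j}\<close>, so one of these can replace \<open>j\<close>. Otherwise each
  candidate \<open>a\<close> has a nonzero invisible signal \<open>z a\<close> excited from
  \<open>insert a A\<close>, and subtracting multiples of these from \<open>y\<close> leaves an
  invisible signal excited from \<open>insert j A\<close> alone, with nonzero excitation at
  \<open>j\<close>.\<close>

lemma observable_exchange:
  assumes obs: "observable G (insert j A) B" and "j \<notin> A"
    and y: "\<And>k. k \<in> B \<Longrightarrow> y $ k = 0"
    and supp: "\<And>k. k \<notin> N \<Longrightarrow> ((mat 1 - G) *v y) $ k = 0"
    and yj: "((mat 1 - G) *v y) $ j \<noteq> 0"
  shows "\<exists>a \<in> N - {j} - A. observable G (insert a A) B"
proof (rule ccontr)
  assume "\<not> ?thesis"
  then have "\<exists>z. (\<forall>k\<in>B. z $ k = 0) \<and> (\<forall>k. k \<notin> insert a A \<longrightarrow> ((mat 1 - G) *v z) $ k = 0) \<and> z \<noteq> 0"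
    if "a \<in> N - {j} - A" for a
    using that unfolding observable_def by blast
  then obtain z where z: "\<And>a k. a \<in> N - {j} - A \<Longrightarrow> k \<in> B \<Longrightarrow> z a $ k = 0"
      "\<And>a k. a \<in> N - {j} - A \<Longrightarrow> k \<notin> insert a A \<Longrightarrow> ((mat 1 - G) *v z a) $ k = 0"
      "\<And>a. a \<in> N - {j} - A \<Longrightarrow> z a \<noteq> 0"
    by metis
  have obsA: "observable G A B"
    using observable_mono[OF obs] by blast
  \<comment> \<open>\<open>e a\<close> is the pivot: it is nonzero because otherwise
    \<open>z a\<close> would be excited from \<open>A\<close> alone. Dividing by it makes
    \<open>c a *s z a\<close> cancel the excitation of \<open>y\<close> at \<open>a\<close>.\<close>
  define e where "e a = ((mat 1 - G) *v z a) $ a" for a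
  have e: "e a \<noteq> 0" if "a \<in> N - {j} - A" for a
  proof
    assume "e a = 0"
    then have "z a = 0"
      using z(1,2)[OF that] by (intro observableD[OF obsA]) (auto simp: e_def, metis insertE)
    with z(3)[OF that] show False by simp
  qed
  define c where "c a = ((mat 1 - G) *v y) $ a / e a" for a
  define w where "w = y - (\<Sum>a\<in>N - {j} - A. c a *s z a)"
  have Gw: "((mat 1 - G) *v w) $ k =
      ((mat 1 - G) *v y) $ k - (\<Sum>a\<in>N - {j} - A. c a * ((mat 1 - G) *v z a) $ k)" for k
    by (simp add: w_def matrix_vector_mult_diff_distrib matrix_vector_mult_lincomb)
  have "w = 0"
  proof (rule observableD[OF obs])
    show "w $ k = 0" if "k \<in> B" for k
      using that y z(1) by (simp add: w_def)
    fix k assume k: "k \<notin> insert j A"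
    show "((mat 1 - G) *v w) $ k = 0"
    proof (cases "k \<in> N")
      case True
      then have kN: "k \<in> N - {j} - A" using k by auto
      have "(\<Sum>a\<in>N - {j} - A. c a * ((mat 1 - G) *v z a) $ k) =
          (\<Sum>a\<in>N - {j} - A. if a = k then ((mat 1 - G) *v y) $ k else 0)"
        using k e[OF kN] by (intro sum.cong) (auto simp: z(2) c_def e_def)
      also have "\<dots> = ((mat 1 - G) *v y) $ k"
        using kN by simp
      finally show ?thesis by (simp add: Gw)
    next
      case False
      then have "((mat 1 - G) *v z a) $ k = 0" if "a \<in> N - {j} - A" for a
        using that k by (intro z(2)) auto
      then have "(\<Sum>a\<in>N - {j} - A. c a * ((mat 1 - G) *v z a) $ k) = 0"
        by (intro sum.neutral) simp
      then show ?thesis using supp[OF False] by (simp add: Gw)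
    qed
  qed
  moreover have "(\<Sum>a\<in>N - {j} - A. c a * ((mat 1 - G) *v z a) $ j) = 0"
    using \<open>j \<notin> A\<close> by (intro sum.neutral) (auto simp: z(2))
  ultimately show False
    using Gw[of j] yj by simp
qed

text \<open>The vectors, completed to a basis, are rows of an invertible matrix. Its determinant has
  a nonzero Leibniz term, whose permutation picks nonzero entries in distinct columns;
  \<open>\<sigma>\<close> is its restriction to the given vectors.\<close>

lemma independent_transversal:
  fixes f :: "'i \<Rightarrow> 'a::field^'n"
  assumes fin: "finite I" and indep: "\<And>c i. (\<Sum>i\<in>I. c i *s f i) = 0 \<Longrightarrow> i \<in> I \<Longrightarrow> c i = 0"
  shows "\<exists>\<sigma>. inj_on \<sigma> I \<and> (\<forall>i\<in>I. f i $ \<sigma> i \<noteq> 0)"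
proof -
  have inj: "inj_on f I"
  proof (rule inj_onI, rule ccontr)
    fix x y assume xy: "x \<in> I" "y \<in> I" "f x = f y" "x \<noteq> y"
    let ?c = "\<lambda>i. (if i = x then 1 else 0) - (if i = y then 1 else 0 :: 'a)"
    have "(\<Sum>i\<in>I. ?c i *s f i) = (\<Sum>i\<in>I. if i = x then f x else 0) - (\<Sum>i\<in>I. if i = y then f y else 0)"
      unfolding sum_subtractf[symmetric] by (intro sum.cong) (auto simp: vec_eq_iff)
    also have "\<dots> = 0"
      using xy fin by simp
    finally show False
      using indep[of ?c x] xy by simp
  qed
  have ind: "vec.independent (f ` I)"
  proof (rule vec.independent_if_scalars_zero)
    fix u x assume u: "(\<Sum>v\<in>f ` I. u v *s v) = 0" and x: "x \<in> f ` I"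
    then have "(\<Sum>i\<in>I. u (f i) *s f i) = 0"
      by (simp add: sum.reindex[OF inj])
    then show "u x = 0" using indep[of "u \<circ> f"] x by auto
  qed (simp add: fin)
  define B where "B = vec.extend_basis (f ` I)"
  have B: "f ` I \<subseteq> B" "vec.independent B" "vec.span B = UNIV"
    using vec.extend_basis_superset[OF ind] vec.independent_extend_basis[OF ind]
      vec.span_extend_basis[OF ind] by (auto simp: B_def)
  have "finite B"
    using B(2) vec.independent_explicit by blast
  moreover have "card B = CARD('n)"
    using vec.basis_card_eq_dim[of B UNIV] B vec_dim_card by auto
  ultimately obtain g where g: "bij_betw g (UNIV :: 'n set) B"
    using finite_same_card_bij[of "UNIV :: 'n set" B] by auto
  define A :: "'a^'n^'n" where "A = (\<chi> i. g i)"
  have "rows A = B"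
    using g by (auto simp: rows_def row_def A_def bij_betw_def)
  then have "\<exists>A'. A' ** A = mat 1"
    using B(3) by (simp add: matrix_left_invertible_span_rows_gen)
  then have "det A \<noteq> 0"
    by (metis invertible_left_inverse invertible_det_nz)
  then obtain q where q: "q permutes (UNIV :: 'n set)" "\<And>i. A $ i $ q i \<noteq> 0"
    unfolding det_def by (metis (mono_tags, lifting) UNIV_I finite mem_Collect_eq mult_zero_right prod_zero sum.neutral)
  define \<sigma> where "\<sigma> i = q (inv_into UNIV g (f i))" for i
  have gi: "g (inv_into UNIV g (f i)) = f i" if "i \<in> I" for i
    using g B(1) that by (intro f_inv_into_f) (auto simp: bij_betw_def)
  have "inj_on \<sigma> I"
  proof (rule inj_onI)
    fix x y assume xy: "x \<in> I" "y \<in> I" "\<sigma> x = \<sigma> y"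
    then have "inv_into UNIV g (f x) = inv_into UNIV g (f y)"
      using permutes_inj[OF q(1)] by (auto simp: \<sigma>_def inj_def)
    then have "f x = f y" using gi xy by metis
    then show "x = y" using inj xy by (auto dest: inj_onD)
  qed
  moreover have "f i $ \<sigma> i \<noteq> 0" if "i \<in> I" for i
    using q(2)[of "inv_into UNIV g (f i)"] gi[OF that] by (simp add: \<sigma>_def A_def)
  ultimately show ?thesis by blast
qed

text \<open>Observability makes the unit vectors of \<open>A\<close> and the columns of I - G
  outside \<open>B\<close> jointly independent. A transversal sends \<open>Inl a\<close> to
  \<open>a\<close>, hence by injectivity no \<open>Inr k\<close> into \<open>A\<close>; a nonzero
  entry in column \<open>k\<close> lies in row \<open>k\<close> or at the head of an edge leaving
  \<open>k\<close>, so the transversal traces disjoint paths.\<close>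

lemma card_le_max_disjoint_paths_of_observable:
  fixes E :: "('n::finite \<times> 'n) set" and G :: "'a::field^'n^'n"
  assumes "consistent E G" and obs: "observable G A B" and "A \<subseteq> N"
  shows "card A \<le> max_disjoint_paths E N B"
proof -
  define f where "f = case_sum (\<lambda>a. axis a (1 :: 'a)) (\<lambda>k. (mat 1 - G) *v axis k 1 :: 'a^'n)"
  define I where "I = Inl ` A \<union> Inr ` (- B)"
  have "\<exists>\<sigma>. inj_on \<sigma> I \<and> (\<forall>i\<in>I. f i $ \<sigma> i \<noteq> 0)"
  proof (rule independent_transversal)
    fix c i assume c: "(\<Sum>i\<in>I. c i *s f i) = 0" and i: "i \<in> I"
    define y :: "'a^'n" where "y = (\<Sum>k\<in>- B. c (Inr k) *s axis k 1)"
    define x :: "'a^'n" where "x = (\<Sum>a\<in>A. c (Inl a) *s axis a 1)"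
    have comp: "(\<Sum>k\<in>K. d k *s axis k (1 :: 'a)) $ l = (if l \<in> K then d l else 0)" for K d and l :: 'n
    proof -
      have "(\<Sum>k\<in>K. d k *s axis k (1 :: 'a)) $ l = (\<Sum>k\<in>K. if k = l then d k else 0)"
        unfolding sum_component by (intro sum.cong) (auto simp: axis_def)
      then show ?thesis by (simp add: sum.delta)
    qed
    have "(mat 1 - G) *v y = (\<Sum>k\<in>- B. c (Inr k) *s ((mat 1 - G) *v axis k 1))"
      by (simp add: y_def matrix_vector_mult_lincomb)
    moreover have "(\<Sum>i\<in>I. c i *s f i) = (\<Sum>i\<in>Inl ` A. c i *s f i) + (\<Sum>i\<in>Inr ` (- B). c i *s f i)"
      unfolding I_def by (rule sum.union_disjoint) auto
    ultimately have "x + (mat 1 - G) *v y = 0"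
      using c by (simp add: sum.reindex f_def x_def)
    then have Gy: "(mat 1 - G) *v y = - x"
      by (simp add: eq_neg_iff_add_eq_0 add.commute)
    have "y = 0"
    proof (rule observableD[OF obs])
      show "y $ k = 0" if "k \<in> B" for k
        unfolding y_def comp using that by simp
      show "((mat 1 - G) *v y) $ k = 0" if "k \<notin> A" for k
        unfolding Gy vector_uminus_component x_def comp using that by simp
    qed
    then have "x = 0"
      using Gy by simp
    show "c i = 0"
    proof (cases i)
      case (Inl a)
      then show ?thesis
        using i \<open>x = 0\<close> comp[of "\<lambda>a. c (Inl a)" A a] by (auto simp: I_def simp flip: x_def)
    next
      case (Inr k)
      then show ?thesis
        using i \<open>y = 0\<close> comp[of "\<lambda>k. c (Inr k)" "- B" k] by (auto simp: I_def simp flip: y_def)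
    qed
  qed (simp add: I_def)
  then obtain \<sigma> where \<sigma>: "inj_on \<sigma> I" "\<And>i. i \<in> I \<Longrightarrow> f i $ \<sigma> i \<noteq> 0"
    by auto
  have \<sigma>A: "\<sigma> (Inl a) = a" if "a \<in> A" for a
    using \<sigma>(2)[of "Inl a"] that by (auto simp: I_def f_def axis_def split: if_splits)
  have "\<exists>S. disjoint_path_family E A B S \<and> card S = card A"
  proof (rule disjoint_path_family_of_injection[of "\<lambda>k. \<sigma> (Inr k)"])
    show "inj_on (\<lambda>k. \<sigma> (Inr k)) (- B)"
      using \<sigma>(1) by (auto simp: inj_on_def I_def)
    show "\<sigma> (Inr k) \<notin> A" if "k \<notin> B" for k
      using inj_onD[OF \<sigma>(1), of "Inl (\<sigma> (Inr k))" "Inr k"] \<sigma>A that by (auto simp: I_def)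
    show "\<sigma> (Inr k) = k \<or> (k, \<sigma> (Inr k)) \<in> E" if "k \<notin> B" for k
    proof -
      have "((mat 1 - G) *v axis k 1) $ \<sigma> (Inr k) = (mat 1 - G) $ \<sigma> (Inr k) $ k"
        by (simp add: matrix_vector_mult_def axis_def if_distrib cong: if_cong)
      then have "(mat 1 - G) $ \<sigma> (Inr k) $ k \<noteq> 0"
        using \<sigma>(2)[of "Inr k"] that by (simp add: I_def f_def)
      then show ?thesis
        using assms(1) by (cases "(k, \<sigma> (Inr k)) \<in> E") (auto simp: mat_def consistent_def split: if_splits)
    qed
  qed
  then obtain S where S: "disjoint_path_family E A B S" "card S = card A"
    by blast
  have "disjoint_path_family E N B S"
    using S(1) \<open>A \<subseteq> N\<close> by (auto simp: disjoint_path_family_def)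
  then show ?thesis
    using card_le_max_disjoint_paths(1) S(2) by metis
qed

section \<open>Disjoint paths give generic observability\<close>

text \<open>The Leibniz formula uses only ring operations. Instances are evaluation of polynomials,
  their embedding into fractions, and \<open>of_delay\<close>.\<close>

lemma det_ring_hom:
  fixes h :: "'a::comm_ring_1 \<Rightarrow> 'b::comm_ring_1" and A :: "'a^'n^'n"
  assumes one: "h 1 = 1" and add: "\<And>x y. h (x + y) = h x + h y"
    and mult: "\<And>x y. h (x * y) = h x * h y"
  shows "h (det A) = det (\<chi> i j. h (A $ i $ j))"
proof -
  have zero: "h 0 = 0"
    using add[of 0 0] by simp
  have minus: "h (- x) = - h x" for x
    using add[of x "- x"] zero by (simp add: eq_neg_iff_add_eq_0 add.commute)
  have sum: "h (sum f A) = (\<Sum>a\<in>A. h (f a))" for f :: "'c \<Rightarrow> 'a" and A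
    by (induction A rule: infinite_finite_induct) (simp_all add: zero add)
  have prod: "h (prod f A) = (\<Prod>a\<in>A. h (f a))" for f :: "'c \<Rightarrow> 'a" and A
    by (induction A rule: infinite_finite_induct) (simp_all add: one mult)
  have sgn: "h (of_int (sign p)) = of_int (sign p)" for p :: "'c \<Rightarrow> 'c"
    by (simp add: sign_def one minus)
  show ?thesis
    by (simp add: det_def sum prod sgn mult)
qed

lemma ker_eq_0_of_det_nonzero:
  fixes A :: "'a::field^'n^'n"
  assumes "det A \<noteq> 0" "A *v x = 0"
  shows "x = 0"
  using assms by (metis invertible_det_nz invertible_left_inverse matrix_left_invertible_ker)

lemma det_nonzero_of_ker:
  fixes A :: "'a::field^'n^'n"
  assumes "\<And>x. A *v x = 0 \<Longrightarrow> x = 0"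
  shows "det A \<noteq> 0"
  using assms by (metis invertible_det_nz invertible_left_inverse matrix_left_invertible_ker)

lemma poly_1_monic_poly: "poly (monic_poly d c) 1 = 1 + (\<Sum>m<d. c m)"
  by (simp add: monic_poly_def poly_sum poly_monom)

lemma monic_poly_nonzero: "monic_poly d c \<noteq> 0"
proof -
  have "coeff (monic_poly d c) d = 1"
    by (simp add: monic_poly_def coeff_sum coeff_monom)
  then show ?thesis by auto
qed

lemma finite_parameters: "finite (parameters (E :: ('n::finite \<times> 'n) set) n)"
proof -
  have "parameters E n = (\<Union>(j, i)\<in>E. {Kappa i j} \<union> Alpha i j ` {..<n i j} \<union> Beta i j ` {..<n i j})"
    by (auto simp: parameters_def)
  then show ?thesis by auto
qed

definition edge_num :: "('n \<times> 'n) set \<Rightarrow> ('n \<Rightarrow> 'n \<Rightarrow> nat) \<Rightarrow> ('n parameter \<Rightarrow> real) \<Rightarrow> 'n \<Rightarrow> 'n \<Rightarrow> real poly" where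
  "edge_num E n P l k = (if (k, l) \<in> E
     then smult (P (Kappa l k)) (monic_poly (n l k) (\<lambda>m. P (Beta l k m))) else 0)"

definition edge_den :: "('n \<times> 'n) set \<Rightarrow> ('n \<Rightarrow> 'n \<Rightarrow> nat) \<Rightarrow> ('n \<Rightarrow> 'n \<Rightarrow> nat) \<Rightarrow>
    ('n parameter \<Rightarrow> real) \<Rightarrow> 'n \<Rightarrow> 'n \<Rightarrow> real poly" where
  "edge_den E p n P l k = (if (k, l) \<in> E
     then monom 1 (p l k) * monic_poly (n l k) (\<lambda>m. P (Alpha l k m)) else 1)"

lemma edge_den_nonzero: "edge_den E p n P l k \<noteq> 0"
  by (simp add: edge_den_def monic_poly_nonzero)

lemma parametrized_matrix_eq:
  "parametrized_matrix E p n P $ l $ k = Fract (edge_num E n P l k) (edge_den E p n P l k)"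
  by (simp add: parametrized_matrix_def edge_num_def edge_den_def Zero_fract_def)

text \<open>
  With \<open>a c\<close> the start of the path ending in \<open>c\<close>, the matrix \<open>M\<close> is \<open>I - G\<close> with each column \<open>c\<close>
  at which a path ends replaced by the unit vector of \<open>a c\<close>; invertibility of \<open>M\<close> is observability.
  Clearing denominators and evaluating at \<open>z = 1\<close> turns \<open>det M\<close> into a polynomial in the
  parameters, which does not vanish when the gains are \<open>1\<close> along the paths and \<open>0\<close> elsewhere.
\<close>

lemma AE_observable:
  fixes E :: "('n::finite \<times> 'n) set"
  assumes S: "disjoint_path_family E A B S"
  shows "AE P in Pi\<^sub>M (parameters E n) (\<lambda>_. lborel).
    observable (parametrized_matrix E p n P) (hd ` S) B"
proof -
  note path = disjoint_path_familyD[OF S]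
  define a where "a c = hd (inv_into S last c)" for c
  have a: "a (last ps) = hd ps" if "ps \<in> S" for ps
    using that inj_on_last_disjoint_path_family[OF S] by (simp add: a_def)
  define L where "L = last ` S"
  have inj_a: "inj_on a L"
    using a inj_on_hd_disjoint_path_family[OF S] by (auto simp: inj_on_def L_def)
  \<comment> \<open>\<open>D P k\<close> clears the denominators of column \<open>k\<close>; columns
    in \<open>L\<close> have constant entries. \<open>N\<close> is then \<open>M\<close> with column
    \<open>k\<close> multiplied by \<open>D P k\<close>.\<close>
  define D where "D P k = (if k \<in> L then 1 else \<Prod>l\<in>UNIV. edge_den E p n P l k)" for P k
  define M where "M P = (\<chi> l k. if k \<in> L then (if l = a k then 1 else 0)
      else (mat 1 - parametrized_matrix E p n P) $ l $ k)" for P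
  define N where "N P = (\<chi> l k. if k \<in> L then (if l = a k then 1 else 0)
      else (if l = k then D P k else 0)
        - edge_num E n P l k * (\<Prod>l'\<in>UNIV - {l}. edge_den E p n P l' k))" for P
  \<comment> \<open>At z = 1 every factor \<open>monom 1 (p l k)\<close> is 1, so the entries of
    \<open>H\<close> are real polynomials in the parameters, whatever the delays.\<close>
  define H where "H P = (\<chi> l k. poly (N P $ l $ k) 1)" for P
  have D0: "D P k \<noteq> 0" for P k
    by (simp add: D_def edge_den_nonzero)
  have NM: "Fract (N P $ l $ k) 1 = M P $ l $ k * Fract (D P k) 1" for P l k
  proof (cases "k \<in> L")
    case True
    then show ?thesis
      by (simp add: N_def M_def D_def Zero_fract_def One_fract_def)
  next
    case False
    have "(\<Prod>l\<in>UNIV. edge_den E p n P l k) =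
        edge_den E p n P l k * (\<Prod>l'\<in>UNIV - {l}. edge_den E p n P l' k)"
      by (rule prod.remove) auto
    then have "parametrized_matrix E p n P $ l $ k * Fract (D P k) 1 =
        Fract (edge_num E n P l k * (\<Prod>l'\<in>UNIV - {l}. edge_den E p n P l' k)) 1"
      using False
      by (simp add: D_def parametrized_matrix_eq eq_fract edge_den_nonzero mult_ac)
    moreover have "mat 1 $ l $ k * Fract (D P k) 1 = Fract (if l = k then D P k else 0) 1"
      by (simp add: mat_def Zero_fract_def)
    ultimately show ?thesis
      using False by (simp add: N_def M_def left_diff_distrib)
  qed
  have MH: "det (M P) \<noteq> 0" if "det (H P) \<noteq> 0" for P
  proof (rule det_nonzero_of_ker)
    fix w assume w: "M P *v w = 0"
    have "poly (det (N P)) 1 = det (H P)"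
      unfolding H_def by (rule det_ring_hom) simp_all
    then have "det (N P) \<noteq> 0" using that by auto
    then have "Fract (det (N P)) 1 \<noteq> 0"
      by (simp add: Zero_fract_def eq_fract)
    moreover define K where "K = (\<chi> l k. Fract (N P $ l $ k) 1)"
    moreover have "Fract (det (N P)) 1 = det (\<chi> l k. Fract (N P $ l $ k) 1)"
      by (rule det_ring_hom) (simp_all add: One_fract_def)
    ultimately have "det K \<noteq> 0" by simp
    define x where "x = (\<chi> k. w $ k / Fract (D P k) 1)"
    have Dx: "Fract (D P k) 1 * x $ k = w $ k" for k
    proof -
      have "Fract (D P k) 1 \<noteq> 0"
        using D0[of P k] by (simp add: Zero_fract_def eq_fract)
      then show ?thesis
        unfolding x_def vec_lambda_beta times_divide_eq_right by (rule nonzero_mult_div_cancel_left)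
    qed
    have "(K *v x) $ l = (M P *v w) $ l" for l
      unfolding matrix_vector_mult_def K_def vec_lambda_beta NM mult.assoc Dx ..
    then have "K *v x = 0"
      using w by (simp add: vec_eq_iff)
    then have "x = 0"
      by (rule ker_eq_0_of_det_nonzero[OF \<open>det K \<noteq> 0\<close>])
    then show "w = 0"
      using Dx by (metis mult_zero_right vec_eq_iff zero_index)
  qed
  have obs: "observable (parametrized_matrix E p n P) (hd ` S) B" if "det (M P) \<noteq> 0" for P
    unfolding observable_def
  proof (intro allI impI, elim conjE)
    let ?G = "parametrized_matrix E p n P"
    fix y assume y: "\<forall>k\<in>B. y $ k = 0"
      and supp: "\<forall>k. k \<notin> hd ` S \<longrightarrow> ((mat 1 - ?G) *v y) $ k = 0"
    have yL: "y $ k = 0" if "k \<in> L" for k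
      using that y path(4) by (auto simp: L_def)
    \<comment> \<open>Since \<open>y\<close> vanishes on \<open>L\<close>, these entries are free to
      store the excitation with a minus sign: \<open>M P *v w\<close> becomes
      \<open>(mat 1 - ?G) *v y\<close> minus its restriction to the path starts, which is zero
      because the excitation is supported there.\<close>
    define w where "w = (\<chi> k. if k \<in> L then - ((mat 1 - ?G) *v y) $ a k else y $ k)"
    have "(M P *v w) $ l = 0" for l
    proof -
      have "(M P *v w) $ l = (\<Sum>k\<in>UNIV. (mat 1 - ?G) $ l $ k * y $ k
          - (if k \<in> L \<and> l = a k then ((mat 1 - ?G) *v y) $ a k else 0))"
        unfolding matrix_vector_mult_def[of "M P"]
        by (simp add: M_def w_def yL cong: if_cong) (intro sum.cong, auto simp: yL)
      also have "\<dots> = ((mat 1 - ?G) *v y) $ l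
          - (\<Sum>k\<in>L. if l = a k then ((mat 1 - ?G) *v y) $ a k else 0)"
        by (simp add: sum_subtractf matrix_vector_mult_def[of _ y] sum.If_cases sum.inter_restrict[symmetric] Int_def)
      also have "(\<Sum>k\<in>L. if l = a k then ((mat 1 - ?G) *v y) $ a k else 0) =
          (\<Sum>b\<in>a ` L. if l = b then ((mat 1 - ?G) *v y) $ b else 0)"
        by (simp add: sum.reindex[OF inj_a])
      also have "\<dots> = ((mat 1 - ?G) *v y) $ l"
      proof -
        have "a ` L = hd ` S"
          using a by (force simp: L_def image_iff)
        then show ?thesis using supp by (auto simp: sum.delta)
      qed
      finally show ?thesis by simp
    qed
    then have "w = 0"
      using ker_eq_0_of_det_nonzero[OF that] by (simp add: vec_eq_iff)
    show "y = 0"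
    proof (simp add: vec_eq_iff, rule allI)
      fix k show "y $ k = 0"
        using yL[of k] arg_cong[OF \<open>w = 0\<close>, of "\<lambda>v. v $ k"] by (cases "k \<in> L") (auto simp: w_def)
    qed
  qed
  have "AE P in Pi\<^sub>M (parameters E n) (\<lambda>_. lborel). det (H P) \<noteq> 0"
  proof (rule AE_polynomial_nonzero[OF finite_parameters])
    have num: "polynomial_on (parameters E n) (\<lambda>P. poly (edge_num E n P l k) 1)" for l k
    proof (cases "(k, l) \<in> E")
      case True
      then have "Kappa l k \<in> parameters E n" "\<And>m. m < n l k \<Longrightarrow> Beta l k m \<in> parameters E n"
        by (auto simp: parameters_def)
      then show ?thesis
        using True by (simp add: edge_num_def poly_1_monic_poly)
          (intro polynomial_on_mult polynomial_on_add polynomial_on_const polynomial_on_sum polynomial_on_coord; simp)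
    qed (simp add: edge_num_def polynomial_on_const)
    have den: "polynomial_on (parameters E n) (\<lambda>P. poly (edge_den E p n P l k) 1)" for l k
    proof (cases "(k, l) \<in> E")
      case True
      then have "\<And>m. m < n l k \<Longrightarrow> Alpha l k m \<in> parameters E n"
        by (auto simp: parameters_def)
      then show ?thesis
        using True by (simp add: edge_den_def poly_1_monic_poly poly_monom)
          (intro polynomial_on_add polynomial_on_const polynomial_on_sum polynomial_on_coord; simp)
    qed (simp add: edge_den_def polynomial_on_const)
    show "polynomial_on (parameters E n) (\<lambda>P. det (H P))"
    proof (rule polynomial_on_det)
      fix l k
      show "polynomial_on (parameters E n) (\<lambda>P. H P $ l $ k)"
      proof (cases "k \<in> L")
        case True
        then show ?thesis by (simp add: H_def N_def polynomial_on_const)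
      next
        case False
        have "polynomial_on (parameters E n) (\<lambda>P. if l = k then \<Prod>l'\<in>UNIV. poly (edge_den E p n P l' k) 1 else 0)"
          by (cases "l = k") (auto intro: polynomial_on_prod den polynomial_on_const)
        then have "polynomial_on (parameters E n) (\<lambda>P.
            (if l = k then \<Prod>l'\<in>UNIV. poly (edge_den E p n P l' k) 1 else 0) -
            poly (edge_num E n P l k) 1 * (\<Prod>l'\<in>UNIV - {l}. poly (edge_den E p n P l' k) 1))"
          by (intro polynomial_on_diff polynomial_on_mult polynomial_on_prod num den)
        then show ?thesis
          using False by (simp add: H_def N_def D_def poly_prod if_distrib[of "\<lambda>q. poly q 1"] cong: if_cong)
      qed
    qed
    define F where "F = {(ps ! t, ps ! Suc t) | ps t. ps \<in> S \<and> Suc t < length ps}"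
    \<comment> \<open>Unit gain on the path edges, all other parameters zero: at z = 1 every
      numerator is the indicator of \<open>F\<close> and every denominator is 1.\<close>
    define P0 where "P0 = restrict (\<lambda>x. case x of Kappa l k \<Rightarrow> of_bool ((k, l) \<in> F) | _ \<Rightarrow> (0 :: real))
        (parameters E n)"
    show "P0 \<in> extensional (parameters E n)"
      by (simp add: P0_def)
    have FE: "F \<subseteq> E"
      using path(5) by (auto simp: F_def)
    have succ: "((ps ! t, l) \<in> F) = (l = ps ! Suc t)" if "ps \<in> S" "Suc t < length ps" for ps t l
    proof
      assume "(ps ! t, l) \<in> F"
      then obtain qs s where qs: "qs \<in> S" "Suc s < length qs" "ps ! t = qs ! s" "l = qs ! Suc s"
        by (auto simp: F_def)
      then have "ps = qs"
        using that by (metis Suc_lessD nth_mem path(6))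
      moreover have "t = s"
        using qs that path(2)[of ps] \<open>ps = qs\<close> by (auto simp: nth_eq_iff_index_eq)
      ultimately show "l = ps ! Suc t" using qs by simp
    qed (use that in \<open>auto simp: F_def\<close>)
    have num0: "poly (edge_num E n P0 l k) 1 = of_bool ((k, l) \<in> F)" for l k
    proof (cases "(k, l) \<in> E")
      case True
      then have "Kappa l k \<in> parameters E n" "\<And>m. m < n l k \<Longrightarrow> Beta l k m \<in> parameters E n"
        by (auto simp: parameters_def)
      then show ?thesis
        using True by (simp add: edge_num_def poly_1_monic_poly P0_def)
    next
      case False
      then show ?thesis using FE by (auto simp: edge_num_def)
    qed
    have den0: "poly (edge_den E p n P0 l k) 1 = 1" for l k
    proof (cases "(k, l) \<in> E")
      case True
      then have "\<And>m. m < n l k \<Longrightarrow> Alpha l k m \<in> parameters E n"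
        by (auto simp: parameters_def)
      then show ?thesis
        using True by (simp add: edge_den_def poly_1_monic_poly P0_def poly_monom)
    qed (simp add: edge_den_def)
    have H0: "H P0 $ l $ k = (if k \<in> L then of_bool (l = a k) else of_bool (l = k) - of_bool ((k, l) \<in> F))" for l k
      by (simp add: H_def N_def D_def poly_prod num0 den0 del: sum_of_bool_eq)
    \<comment> \<open>For a left kernel vector \<open>v\<close>, the columns in \<open>L\<close>
      give zeros at the path starts, and every other column on a path makes its values at
      consecutive nodes equal, so zero spreads along the paths. Off the paths no edge of
      \<open>F\<close> starts, so \<open>v\<close> is zero directly.\<close>
    have "det (transpose (H P0)) \<noteq> 0"
    proof (rule det_nonzero_of_ker)
      fix v assume v: "transpose (H P0) *v v = 0"
      have col: "(\<Sum>l\<in>UNIV. H P0 $ l $ k * v $ l) = 0" for k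
        using arg_cong[OF v, of "\<lambda>v. v $ k"] unfolding matrix_vector_mult_def transpose_def by simp
      have vL: "v $ a k = 0" if "k \<in> L" for k
        using col[of k] that by (simp add: H0 of_bool_def if_distrib[of "\<lambda>q. q * _"] cong: if_cong)
      have step: "v $ k = (\<Sum>l\<in>UNIV. if (k, l) \<in> F then v $ l else 0)" if "k \<notin> L" for k
      proof -
        have "(\<Sum>l\<in>UNIV. H P0 $ l $ k * v $ l) =
           (\<Sum>l\<in>UNIV. (if l = k then v $ l else 0) - (if (k, l) \<in> F then v $ l else 0))"
          using that by (intro sum.cong) (auto simp: H0)
        then show ?thesis
          using col[of k] by (simp add: sum_subtractf)
      qed
      have on_path: "v $ (ps ! t) = 0" if "ps \<in> S" "t < length ps" for ps t
        using that(2)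
      proof (induction t)
        case 0
        then show ?case
          using vL[of "last ps"] a[OF that(1)] that(1) path(1)[OF that(1)]
          by (simp add: L_def hd_conv_nth)
      next
        case (Suc t)
        have "ps ! t \<notin> L"
        proof
          assume "ps ! t \<in> L"
          then obtain qs where qs: "qs \<in> S" "ps ! t = last qs" by (auto simp: L_def)
          then have "ps = qs"
            using path(1)[OF qs(1)] path(6)[OF that(1) qs(1)] Suc.prems
            by (metis Suc_lessD last_in_set nth_mem)
          then have "ps ! t = ps ! (length ps - 1)"
            using qs path(1)[OF qs(1)] by (simp add: last_conv_nth)
          then show False
            using path(2)[OF that(1)] Suc.prems by (simp add: nth_eq_iff_index_eq)
        qed
        then have "v $ (ps ! t) = v $ (ps ! Suc t)"
          using step[of "ps ! t"] succ[OF that(1) Suc.prems] by simp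
        then show ?case using Suc by simp
      qed
      have "v $ k = 0" for k
      proof (cases "\<exists>ps\<in>S. k \<in> set ps")
        case True
        then show ?thesis using on_path by (auto simp: in_set_conv_nth)
      next
        case False
        then have "k \<notin> L" "\<And>l. (k, l) \<notin> F"
          using path(1) by (auto simp: L_def F_def)
        then show ?thesis using step[of k] by simp
      qed
      then show "v = 0" by (simp add: vec_eq_iff)
    qed
    then show "det (H P0) \<noteq> 0" by simp
  qed
  then show ?thesis
    by (rule eventually_mono) (intro obs MH)
qed

section \<open>Polynomials in the delay operator\<close>

lemma poly_map_poly_pCons:
  fixes f :: "'a::comm_ring_1 \<Rightarrow> 'b::comm_ring_1"
  assumes "f 0 = 0"
  shows "poly (map_poly f (pCons c p)) u = f c + u * poly (map_poly f p) u"
  using assms by (simp add: map_poly_pCons)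

text \<open>Two coefficient extensions use this: reals into constant transfer functions, which gives
  \<open>of_delay\<close>, and reals into complex numbers, for evaluation on the unit disc.\<close>

lemma poly_map_poly_hom:
  fixes f :: "'a::comm_ring_1 \<Rightarrow> 'b::comm_ring_1"
  assumes zero: "f 0 = 0" and one: "f 1 = 1" and add: "\<And>x y. f (x + y) = f x + f y"
    and mult: "\<And>x y. f (x * y) = f x * f y"
  shows "poly (map_poly f 1) u = 1"
    and "poly (map_poly f (p + q)) u = poly (map_poly f p) u + poly (map_poly f q) u"
    and "poly (map_poly f (p * q)) u = poly (map_poly f p) u * poly (map_poly f q) u"
proof -
  note pCons = poly_map_poly_pCons[of f, OF zero]
  show "poly (map_poly f 1) u = 1"
    by (simp add: map_poly_1 one)
  have plus: "poly (map_poly f (p + q)) u = poly (map_poly f p) u + poly (map_poly f q) u" for p q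
  proof (induction p arbitrary: q rule: pCons_induct)
    case (pCons a p)
    show ?case
    proof (cases q rule: pCons_cases)
      case (pCons b r)
      then show ?thesis
        by (simp add: poly_map_poly_pCons[of f, OF zero] add pCons.IH algebra_simps)
    qed
  qed simp
  show "poly (map_poly f (p + q)) u = poly (map_poly f p) u + poly (map_poly f q) u"
    by (rule plus)
  have smult: "poly (map_poly f (smult c q)) u = f c * poly (map_poly f q) u" for c q
    by (induction q rule: pCons_induct) (simp_all add: pCons mult algebra_simps)
  show "poly (map_poly f (p * q)) u = poly (map_poly f p) u * poly (map_poly f q) u"
    by (induction p rule: pCons_induct) (simp_all add: pCons plus smult zero algebra_simps)
qed

text \<open>Substitutes the delay z^-1, here \<open>Fract 1 [:0, 1:]\<close>, for the variable. In
  this variable, properness is read off at 0 and stability on the closed unit disc.\<close>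

definition of_delay :: "real poly \<Rightarrow> transfer" where
  "of_delay f = poly (map_poly (\<lambda>c. Fract [:c:] 1) f) (Fract 1 [:0, 1:])"

lemma of_delay_0 [simp]: "of_delay 0 = 0"
  by (simp add: of_delay_def)

lemma of_delay_pCons: "of_delay (pCons c f) = Fract [:c:] 1 + Fract 1 [:0, 1:] * of_delay f"
  unfolding of_delay_def by (rule poly_map_poly_pCons) (simp add: Zero_fract_def)

lemma of_delay_1 [simp]: "of_delay 1 = 1"
  and of_delay_add: "of_delay (f + g) = of_delay f + of_delay g"
  and of_delay_mult: "of_delay (f * g) = of_delay f * of_delay g"
  unfolding of_delay_def
  by (rule poly_map_poly_hom; simp add: Zero_fract_def One_fract_def one_pCons mult.commute)+

lemma of_delay_diff: "of_delay (f - g) = of_delay f - of_delay g"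
  using of_delay_add[of "f - g" g] by simp

lemma of_delay_eq: "of_delay f = Fract (reflect_poly f) (monom 1 (degree f))"
proof (induction f rule: pCons_induct)
  case 0
  then show ?case by (simp add: Zero_fract_def eq_fract)
next
  case (pCons c f)
  show ?case
  proof (cases "f = 0")
    case True
    then show ?thesis by (simp add: of_delay_pCons monom_0 one_pCons)
  next
    case False
    have "[:0, 1:] * monom 1 (degree f) = (monom 1 (Suc (degree f)) :: real poly)"
      by (simp add: monom_Suc)
    moreover have "of_delay (pCons c f) = Fract [:c:] 1 + Fract 1 [:0, 1:] * Fract (reflect_poly f) (monom 1 (degree f))"
      using pCons.IH by (simp add: of_delay_pCons)
    ultimately show ?thesis
      using False by (simp add: reflect_poly_pCons' smult_monom add.commute)
  qed
qed

lemma of_delay_eq_0_iff [simp]: "of_delay f = 0 \<longleftrightarrow> f = 0"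
  by (simp add: of_delay_eq Zero_fract_def eq_fract)

lemma poly_of_real_reflect_poly:
  fixes g :: "real poly" and z :: complex
  assumes "z \<noteq> 0"
  shows "poly (map_poly complex_of_real (reflect_poly g)) z =
    z ^ degree g * poly (map_poly complex_of_real g) (inverse z)"
proof -
  have "map_poly complex_of_real (reflect_poly g) = reflect_poly (map_poly complex_of_real g)"
    by (rule poly_eqI) (simp add: coeff_map_poly coeff_reflect_poly degree_map_poly)
  then show ?thesis
    using assms by (simp add: poly_reflect_poly_nz degree_map_poly)
qed

text \<open>The substitution u = 1/z turns |z| \<ge> 1 into |u| \<le> 1, so a denominator root
  outside the open disc would give a root of \<open>g\<close> in the closed one. The nonzero
  constant coefficient lets \<open>reflect_poly g\<close> keep the degree of \<open>g\<close>, which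
  gives properness.\<close>

lemma proper_stable_ratio:
  assumes g0: "coeff g 0 \<noteq> 0"
    and g: "\<And>u::complex. norm u \<le> 1 \<Longrightarrow> poly (map_poly of_real g) u \<noteq> 0"
  shows "proper (of_delay f / of_delay g)" "stable (of_delay f / of_delay g)"
proof -
  let ?a = "reflect_poly f * monom 1 (degree g)"
  let ?b = "monom 1 (degree f) * reflect_poly g"
  have eq: "of_delay f / of_delay g = Fract ?a ?b"
    by (simp add: of_delay_eq)
  have "g \<noteq> 0" using g0 by auto
  then have b: "?b \<noteq> 0" by simp
  have "degree ?a \<le> degree f + degree g"
    using degree_mult_le[of "reflect_poly f" "monom 1 (degree g)"] degree_reflect_poly_le[of f]
    by (simp add: degree_monom_eq)
  also have "\<dots> = degree ?b"
    using g0 \<open>g \<noteq> 0\<close> by (subst degree_mult_eq) (auto simp: degree_monom_eq)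
  finally show "proper (of_delay f / of_delay g)"
    unfolding proper_def using eq b by blast
  have "norm z < 1" if z: "poly (map_poly complex_of_real ?b) z = 0" for z
  proof (rule ccontr)
    assume "\<not> norm z < 1"
    then have "z \<noteq> 0" "norm (inverse z) \<le> 1"
      by (auto simp: norm_inverse inverse_le_1_iff)
    have hom: "poly (map_poly complex_of_real (p * q)) z =
        poly (map_poly complex_of_real p) z * poly (map_poly complex_of_real q) z" for p q
      by (rule poly_map_poly_hom) simp_all
    have "poly (map_poly complex_of_real ?b) z =
        z ^ degree f * (z ^ degree g * poly (map_poly complex_of_real g) (inverse z))"
      unfolding hom poly_of_real_reflect_poly[OF \<open>z \<noteq> 0\<close>]
      by (simp add: map_poly_monom poly_monom)
    then show False
      using z \<open>z \<noteq> 0\<close> g[OF \<open>norm (inverse z) \<le> 1\<close>] by simp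
  qed
  then show "stable (of_delay f / of_delay g)"
    unfolding stable_def using eq b by blast
qed

text \<open>The indeterminate z is the inverse of \<open>of_delay [:0, 1:]\<close>, so Horner's
  scheme turns polynomials in z, and then fractions, into quotients of delay polynomials.\<close>

lemma of_delay_quotient:
  obtains a b where "b \<noteq> 0" "f = of_delay a / of_delay b"
proof -
  have poly: "\<exists>a b. b \<noteq> 0 \<and> Fract p 1 = of_delay a / of_delay b" for p
  proof (induction p rule: pCons_induct)
    case 0
    then show ?case
      by (intro exI[of _ 0] exI[of _ 1]) (simp add: Zero_fract_def)
  next
    case (pCons c p)
    then obtain a b where ab: "b \<noteq> 0" "Fract p 1 = of_delay a / of_delay b" by auto
    have u: "of_delay [:0, 1:] * Fract [:0, 1:] 1 = 1"
      by (simp add: of_delay_pCons One_fract_def eq_fract Zero_fract_def flip: one_pCons)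
    have "Fract (pCons c p) 1 = Fract [:c:] 1 + Fract [:0, 1:] 1 * Fract p 1"
      by (simp add: pCons_one)
    also have "Fract [:c:] 1 = of_delay [:c:]"
      by (simp add: of_delay_pCons)
    also have "Fract [:0, 1:] 1 = 1 / of_delay [:0, 1:]"
      using u by (simp add: field_simps)
    also have "of_delay [:c:] + 1 / of_delay [:0, 1:] * Fract p 1 =
        of_delay ([:c:] * b * [:0, 1:] + a) / of_delay (b * [:0, 1:])"
      using ab by (simp only: of_delay_add of_delay_mult) (simp add: field_simps)
    finally show ?case
      using ab(1) by (intro exI[of _ "[:c:] * b * [:0, 1:] + a"] exI[of _ "b * [:0, 1:]"]) simp
  qed
  obtain p q where pq: "q \<noteq> 0" "f = Fract p q"
    by (cases f) auto
  obtain a b a' b' where ab: "b \<noteq> 0" "Fract p 1 = of_delay a / of_delay b"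
      "b' \<noteq> 0" "Fract q 1 = of_delay a' / of_delay b'"
    using poly by metis
  have "Fract q 1 \<noteq> 0" using pq by (simp add: Zero_fract_def eq_fract)
  then have "a' \<noteq> 0" using ab by auto
  have "f = Fract p 1 / Fract q 1"
    using pq by simp
  also have "\<dots> = of_delay (a * b') / of_delay (b * a')"
    using ab \<open>a' \<noteq> 0\<close> by (simp add: of_delay_mult)
  finally show ?thesis
    using that ab(1) \<open>a' \<noteq> 0\<close> by (metis no_zero_divisors)
qed

lemma common_delay_denominator:
  fixes d :: "transfer^'n"
  obtains b q where "b \<noteq> 0" "\<And>l. of_delay b * d $ l = of_delay (q l)" "\<And>l. coeff (q l) 0 = 0"
proof -
  have "\<forall>l. \<exists>a b. b \<noteq> 0 \<and> d $ l = of_delay a / of_delay b"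
    by (metis of_delay_quotient)
  then obtain a b where ab: "\<And>l. b l \<noteq> 0" "\<And>l. d $ l = of_delay (a l) / of_delay (b l)"
    by metis
  \<comment> \<open>The extra factor \<open>[:0, 1:]\<close>, one delay, makes the constant terms of
    all \<open>q l\<close> vanish.\<close>
  let ?b = "[:0, 1:] * (\<Prod>l\<in>UNIV. b l)"
  let ?q = "\<lambda>l. [:0, 1:] * (a l * (\<Prod>k\<in>UNIV - {l}. b k))"
  have "?b \<noteq> 0" using ab(1) by simp
  moreover have "of_delay ?b * d $ l = of_delay (?q l)" for l
  proof -
    have "(\<Prod>l\<in>UNIV. b l) = b l * (\<Prod>k\<in>UNIV - {l}. b k)"
      by (rule prod.remove) auto
    then show ?thesis
      using ab(1)[of l] by (simp only: of_delay_mult ab(2)) (simp add: field_simps)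
  qed
  moreover have "coeff (?q l) 0 = 0" for l by simp
  ultimately show ?thesis by (rule that)
qed

section \<open>Networks with small gains\<close>

text \<open>By Cramer's rule every entry of the inverse has denominator \<open>of_delay g\<close>
  with g = det (I - R). The constant term of \<open>g\<close> is 1 because \<open>R\<close> vanishes
  at 0, and \<open>g\<close> has no root in the closed unit disc because I - R is strictly
  diagonally dominant there.\<close>

lemma network_matrix_of_delay:
  fixes R :: "real poly^'n^'n"
  assumes diag: "\<And>k. R $ k $ k = 0" and R0: "\<And>l k. coeff (R $ l $ k) 0 = 0"
    and small: "\<And>l k (u::complex). norm u \<le> 1 \<Longrightarrow>
      norm (poly (map_poly of_real (R $ l $ k)) u) < 1 / real CARD('n)"
  shows "network_matrix (\<chi> l k. of_delay (R $ l $ k))"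
proof -
  define G where "G = (\<chi> l k. of_delay (R $ l $ k))"
  define Q where "Q = mat 1 - R"
  define g where "g = det Q"
  have GQ: "(mat 1 - G) $ l $ k = of_delay (Q $ l $ k)" for l k
    by (simp add: G_def Q_def mat_def of_delay_diff)
  have det: "det (\<chi> l k. of_delay (X $ l $ k)) = of_delay (det X)" for X :: "real poly^'n^'n"
    by (rule det_ring_hom[symmetric]) (simp_all add: of_delay_add of_delay_mult)
  have "poly g 0 = det (\<chi> l k. poly (Q $ l $ k) 0)"
    unfolding g_def by (rule det_ring_hom) simp_all
  also have "(\<chi> l k. poly (Q $ l $ k) 0) = mat 1"
    by (simp add: vec_eq_iff Q_def mat_def poly_0_coeff_0 R0)
  finally have g0: "coeff g 0 \<noteq> 0"
    by (simp add: poly_0_coeff_0)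
  have gu: "poly (map_poly of_real g) u \<noteq> 0" if u: "norm u \<le> 1" for u :: complex
  proof -
    let ?R = "\<lambda>l k. poly (map_poly complex_of_real (R $ l $ k)) u"
    let ?Q = "(\<chi> l k. poly (map_poly complex_of_real (Q $ l $ k)) u) :: complex^'n^'n"
    have hom: "poly (map_poly complex_of_real (p + q)) u =
        poly (map_poly of_real p) u + poly (map_poly of_real q) u" for p q
      by (rule poly_map_poly_hom) simp_all
    have Q: "?Q $ l $ k = (if l = k then 1 else 0) - ?R l k" for l k
    proof -
      have "Q $ l $ k + R $ l $ k = (if l = k then 1 else 0)"
        by (simp add: Q_def mat_def)
      then show ?thesis
        using hom[of "Q $ l $ k" "R $ l $ k"] by (simp add: map_poly_1 eq_diff_eq split: if_splits)
    qed
    have "det ?Q \<noteq> 0"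
    proof (rule det_nonzero_of_ker, rule ccontr)
      fix w assume w: "?Q *v w = 0" and "w \<noteq> 0"
      \<comment> \<open>In a row \<open>l\<close> where the kernel vector attains its largest
        modulus \<open>m\<close>, every term on the right is below \<open>m / real CARD('n)\<close>,
        so they cannot add up to \<open>m\<close>.\<close>
      define m where "m = Max (range (\<lambda>l. norm (w $ l)))"
      have le: "norm (w $ l) \<le> m" for l
        unfolding m_def by (rule Max_ge) auto
      have "m \<in> range (\<lambda>l. norm (w $ l))"
        unfolding m_def by (rule Max_in) auto
      then obtain l where l: "m = norm (w $ l)" by auto
      have "m > 0"
      proof -
        obtain k where "w $ k \<noteq> 0" using \<open>w \<noteq> 0\<close> by (auto simp: vec_eq_iff)
        then show ?thesis using le[of k] by (meson less_le_trans zero_less_norm_iff)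
      qed
      have "(?Q *v w) $ l = (\<Sum>k\<in>UNIV. (if l = k then w $ k else 0) - ?R l k * w $ k)"
        unfolding matrix_vector_mult_def vec_lambda_beta Q[unfolded vec_lambda_beta]
        by (intro sum.cong) (auto simp: algebra_simps)
      then have "w $ l = (\<Sum>k\<in>UNIV. ?R l k * w $ k)"
        using w by (simp add: sum_subtractf)
      then have "m \<le> (\<Sum>k\<in>UNIV. norm (?R l k * w $ k))"
        unfolding l by (metis norm_sum)
      also have "\<dots> < (\<Sum>k\<in>(UNIV :: 'n set). m / real CARD('n))"
      proof (rule sum_strict_mono)
        fix k :: 'n
        have "norm (?R l k * w $ k) \<le> norm (?R l k) * m"
          using le[of k] by (simp add: norm_mult mult_left_mono)
        also have "\<dots> < 1 / real CARD('n) * m"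
          using small[OF u] \<open>m > 0\<close> by (rule mult_strict_right_mono)
        finally show "norm (?R l k * w $ k) < m / real CARD('n)" by simp
      qed auto
      also have "\<dots> = m" by simp
      finally show False by simp
    qed
    moreover have "poly (map_poly complex_of_real g) u = det ?Q"
      unfolding g_def by (rule det_ring_hom; (rule poly_map_poly_hom; simp)?)
    ultimately show ?thesis by simp
  qed
  have "g \<noteq> 0" using g0 by auto
  moreover have "det (mat 1 - G) = of_delay g"
    unfolding g_def det[symmetric] by (rule arg_cong[of _ _ det]) (simp add: vec_eq_iff GQ del: vector_minus_component)
  ultimately have detG: "det (mat 1 - G) = of_delay g" "det (mat 1 - G) \<noteq> 0"
    by simp_all
  then have inv: "invertible (mat 1 - G)"
    by (simp add: invertible_det_nz)
  have entry: "\<exists>f. matrix_inv (mat 1 - G) $ a $ b = of_delay f / of_delay g" for a b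
  proof -
    have "(mat 1 - G) ** matrix_inv (mat 1 - G) = mat 1"
      using inv unfolding invertible_def matrix_inv_def by (metis (mono_tags, lifting) someI_ex)
    then have "(mat 1 - G) *v column b (matrix_inv (mat 1 - G)) = column b (mat 1)"
      by (simp add: matrix_vector_mult_def matrix_matrix_mult_def column_def vec_eq_iff)
    then have "column b (matrix_inv (mat 1 - G)) $ a =
        det (\<chi> i j. if j = a then column b (mat 1) $ i else (mat 1 - G) $ i $ j) / of_delay g"
      using cramer[OF detG(2)] detG(1) by simp
    also have "column b (mat 1) = (\<chi> i. if i = b then 1 else (0 :: transfer))"
      by (simp add: column_def mat_def)
    also have "(\<chi> i j. if j = a then (\<chi> i. if i = b then 1 else 0) $ i else (mat 1 - G) $ i $ j) =
        (\<chi> i j. of_delay ((\<chi> i j. if j = a then (if i = b then 1 else 0) else Q $ i $ j) $ i $ j))"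
      by (simp add: vec_eq_iff GQ del: vector_minus_component)
    finally show ?thesis
      unfolding det by (auto simp: column_def)
  qed
  have wp: "well_posed G"
    unfolding well_posed_def using inv entry proper_stable_ratio[OF g0 gu] by metis
  have "proper (of_delay f)" for f
    using proper_stable_ratio(1)[of 1 f] by (simp add: map_poly_1)
  then show ?thesis
    using wp unfolding network_matrix_def G_def[symmetric] by (simp add: G_def diag)
qed

section \<open>Generic identifiability\<close>

lemma matrix_inv_inverse:
  fixes A :: "'a::field^'n^'n"
  assumes "invertible A"
  shows "A ** matrix_inv A = mat 1" "matrix_inv A ** A = mat 1"
  using someI_ex[OF assms[unfolded invertible_def]] by (simp_all add: matrix_inv_def)

text \<open>With no excitation and no measurement, observability says that I - G has trivial kernel;
  \<open>AE_observable\<close> for the empty path family thus yields generic invertibility.\<close>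

lemma invertible_of_observable:
  fixes G :: "'a::field^'n^'n"
  assumes "observable G {} {}"
  shows "invertible (mat 1 - G)"
proof -
  have "y = 0" if "(mat 1 - G) *v y = 0" for y
    using that by (intro observableD[OF assms]) auto
  then show ?thesis
    by (metis invertible_left_inverse matrix_left_invertible_ker)
qed

lemma selection_matrix_eq:
  fixes C :: "'a::field^'n^'p"
  assumes "selection_matrix C"
  obtains s where "range s = measured_nodes C" "\<And>r k. C $ r $ k = (if k = s r then 1 else 0)"
proof -
  obtain s where s: "\<And>r. C $ r = axis (s r) 1"
    using assms unfolding selection_matrix_def by metis
  then have "C $ r $ k = (if k = s r then 1 else 0)" for r k
    by (simp add: axis_def)
  moreover from this have "range s = measured_nodes C"
    by (auto simp: measured_nodes_def split: if_splits)
  ultimately show ?thesis using that by blast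
qed

lemma selection_matrix_mult:
  fixes C :: "'a::field^'n^'p" and X :: "'a^'m^'n"
  assumes "\<And>r k. C $ r $ k = (if k = s r then 1 else 0)"
  shows "(C ** X) $ r = X $ s r"
  by (simp add: matrix_matrix_mult_def assms vec_eq_iff if_distrib[of "\<lambda>x. x * _"] cong: if_cong)

lemma consistent_parametrized_matrix: "consistent E (parametrized_matrix E p n P)"
  by (simp add: consistent_def parametrized_matrix_def)

text \<open>
  Both \<open>C ** T ** (I - G)\<close> and \<open>C ** T' ** (I - G')\<close> equal \<open>C\<close>, so if \<open>C ** T = C ** T'\<close>, then
  the signals \<open>T (G' - G)\<close> all vanish on the measured nodes.
\<close>

lemma generically_identifiable_if:
  fixes E :: "('n::finite \<times> 'n) set" and C :: "transfer^'n^'p::finite"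
  assumes "selection_matrix C"
    and eq: "max_disjoint_paths E (E `` {i}) (measured_nodes C) =
      max_disjoint_paths E (E `` {i} - {j}) (measured_nodes C) + 1"
  shows "generically_identifiable E C i j"
  unfolding generically_identifiable_def
proof (intro allI)
  fix p n
  let ?N = "E `` {i}" and ?B = "measured_nodes C"
  obtain s where s: "range s = ?B" "\<And>r k. C $ r $ k = (if k = s r then 1 else 0)"
    using selection_matrix_eq[OF assms(1)] by blast
  obtain S where S: "disjoint_path_family E ?N ?B S" "card S = max_disjoint_paths E ?N ?B"
    by (rule ex_max_disjoint_path_family)
  define A where "A = hd ` S"
  have A: "A \<subseteq> ?N" "card A = max_disjoint_paths E ?N ?B"
    using S card_image[OF inj_on_hd_disjoint_path_family[OF S(1)]] disjoint_path_familyD(3)[OF S(1)]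
    by (auto simp: A_def)
  have "disjoint_path_family E {} {} {}"
    by (simp add: disjoint_path_family_def)
  from AE_observable[OF this, where n = n and p = p] AE_observable[OF S(1), where n = n and p = p]
  show "AE P in Pi\<^sub>M (parameters E n) (\<lambda>_. lborel).
        \<forall>G'. network_matrix G' \<longrightarrow> consistent E G' \<longrightarrow>
          C ** matrix_inv (mat 1 - parametrized_matrix E p n P) = C ** matrix_inv (mat 1 - G') \<longrightarrow>
          parametrized_matrix E p n P $ j $ i = G' $ j $ i"
  proof eventually_elim
    fix P
    let ?G = "parametrized_matrix E p n P"
    assume empty: "observable ?G (hd ` {}) {}" and obs: "observable ?G (hd ` S) ?B"
    show "\<forall>G'. network_matrix G' \<longrightarrow> consistent E G' \<longrightarrow>
        C ** matrix_inv (mat 1 - ?G) = C ** matrix_inv (mat 1 - G') \<longrightarrow> ?G $ j $ i = G' $ j $ i"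
    proof (intro allI impI, rule ccontr)
      fix G'
      assume G': "network_matrix G'" "consistent E G'"
        and CT: "C ** matrix_inv (mat 1 - ?G) = C ** matrix_inv (mat 1 - G')"
        and ne: "?G $ j $ i \<noteq> G' $ j $ i"
      have inv: "invertible (mat 1 - ?G)" "invertible (mat 1 - G')"
        using empty G'(1) by (auto intro: invertible_of_observable simp: network_matrix_def well_posed_def)
      define T where "T = matrix_inv (mat 1 - ?G)"
      have "C ** T ** (mat 1 - ?G) = C"
        unfolding T_def matrix_mul_assoc[symmetric] matrix_inv_inverse[OF inv(1)] by simp
      moreover have "C ** T ** (mat 1 - G') = C"
        unfolding T_def CT matrix_mul_assoc[symmetric] matrix_inv_inverse[OF inv(2)] by simp
      moreover have "C ** T ** (G' - ?G) = C ** T ** (mat 1 - ?G) - C ** T ** (mat 1 - G')"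
        by (simp add: matrix_matrix_mult_def vec_eq_iff algebra_simps sum_subtractf)
      ultimately have "C ** (T ** (G' - ?G)) = 0"
        by (simp add: matrix_mul_assoc)
      then have row0: "(T ** (G' - ?G)) $ s r $ l = 0" for r l
        using selection_matrix_mult[where X = "T ** (G' - ?G)", OF s(2), of r] by (simp add: vec_eq_iff)
      define y where "y = column i (T ** (G' - ?G))"
      have y: "y $ k = 0" if kB: "k \<in> ?B" for k
      proof -
        obtain r where "k = s r" using kB unfolding s(1)[symmetric] by blast
        then show ?thesis using row0 by (simp add: y_def column_def)
      qed
      have "(mat 1 - ?G) *v y = column i ((mat 1 - ?G) ** (T ** (G' - ?G)))"
        by (simp add: y_def column_def matrix_vector_mult_def matrix_matrix_mult_def)
      also have "(mat 1 - ?G) ** (T ** (G' - ?G)) = G' - ?G"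
        unfolding T_def matrix_mul_assoc matrix_inv_inverse[OF inv(1)] by simp
      finally have Gy: "((mat 1 - ?G) *v y) $ k = G' $ k $ i - ?G $ k $ i" for k
        by (simp add: column_def)
      have supp: "((mat 1 - ?G) *v y) $ k = 0" if "k \<notin> ?N" for k
      proof -
        have "(i, k) \<notin> E" using that by auto
        then have "G' $ k $ i = 0" "?G $ k $ i = 0"
          using G'(2) consistent_parametrized_matrix[of E p n P] unfolding consistent_def by blast+
        then show ?thesis unfolding Gy by simp
      qed
      \<comment> \<open>If \<open>A\<close> contains \<open>j\<close>, the invisible signal
        \<open>y\<close> permits exchanging \<open>j\<close> for another out-neighbour. Either way
        the rank survives the removal of \<open>j\<close>, and the upper bound by paths contradicts
        the drop in the path count.\<close>
      have "\<exists>A'\<subseteq>?N - {j}. card A' = card A \<and> observable ?G A' ?B"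
      proof (cases "j \<in> A")
        case True
        then have "observable ?G (insert j (A - {j})) ?B"
          using obs by (simp add: A_def insert_absorb)
        then have "\<exists>a \<in> ?N - {j} - (A - {j}). observable ?G (insert a (A - {j})) ?B"
        proof (rule observable_exchange)
          show "((mat 1 - ?G) *v y) $ j \<noteq> 0"
            unfolding Gy using ne by simp
        qed (simp_all add: y supp del: vector_minus_component)
        then obtain a where a: "a \<in> ?N - {j} - (A - {j})" "observable ?G (insert a (A - {j})) ?B"
          by blast
        have "card (insert a (A - {j})) = card A"
          using a(1) True card_Suc_Diff1[of A j] by (subst card_insert_disjoint) auto
        then show ?thesis
          using a A(1) by (intro exI[of _ "insert a (A - {j})"]) auto
      next
        case False
        then show ?thesis using A(1) obs by (intro exI[of _ A]) (auto simp: A_def)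
      qed
      then have "card A \<le> max_disjoint_paths E (?N - {j}) ?B"
        using card_le_max_disjoint_paths_of_observable[OF consistent_parametrized_matrix] by metis
      then show False using A(2) eq by simp
    qed
  qed
qed

text \<open>The measure of the box is a finite product of positive lengths, so small gains cannot be
  discarded as exceptional.\<close>

lemma not_AE_not_in_box:
  fixes I :: "'i set"
  assumes "finite I" "\<delta> > 0"
  shows "\<not> (AE P in Pi\<^sub>M I (\<lambda>_. lborel). P \<notin> Pi\<^sub>E I (\<lambda>_. {- \<delta><..<\<delta> :: real}))"
proof
  interpret product_sigma_finite "\<lambda>_ :: 'i. lborel :: real measure" ..
  let ?M = "Pi\<^sub>M I (\<lambda>_. lborel :: real measure)" and ?X = "Pi\<^sub>E I (\<lambda>_. {- \<delta><..<\<delta> :: real})"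
  assume *: "AE P in ?M. P \<notin> ?X"
  have "?X \<in> sets ?M"
    using assms by (intro sets_PiM_I_finite) auto
  moreover have "{P \<in> space ?M. \<not> P \<notin> ?X} = ?X"
    by (auto simp: space_PiM PiE_def)
  ultimately have "emeasure ?M ?X = 0"
    using * AE_iff_measurable[of ?X ?M "\<lambda>P. P \<notin> ?X"] by simp
  moreover have "emeasure ?M ?X = (\<Prod>x\<in>I. emeasure lborel {- \<delta><..<\<delta>})"
    using assms by (intro emeasure_PiM) auto
  ultimately show False
    using assms by (auto simp: ennreal_eq_0_iff)
qed

lemma complex_poly_bounded_unit_disc:
  fixes q :: "complex poly"
  obtains K where "K > 0" "\<And>u. norm u \<le> 1 \<Longrightarrow> norm (poly q u) < K"
proof -
  have "compact (poly q ` cball 0 1)"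
    by (intro compact_continuous_image continuous_intros) auto
  then obtain K where K: "K > 0" "\<forall>x\<in>poly q ` cball 0 1. norm x \<le> K"
    using compact_imp_bounded bounded_pos by blast
  have "norm (poly q u) < K + 1" if "norm u \<le> 1" for u
  proof -
    have "norm (poly q u) \<le> K" using K(2) that by auto
    then show ?thesis by simp
  qed
  with K(1) show ?thesis by (intro that[of "K + 1"]) auto
qed

text \<open>
  Multiplying by a common denominator makes an unobservable excitation a polynomial in \<open>z\<^sup>-\<^sup>1\<close>
  without constant term; after scaling by a small constant, adding it to column \<open>i\<close> of a small-gain network gives another network with the
  same \<open>C ** T\<close>.
\<close>

lemma ex_indistinguishable_network:
  fixes E :: "('n::finite \<times> 'n) set" and C :: "transfer^'n^'p::finite"
  assumes "irrefl E" and C: "selection_matrix C"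
    and small: "\<And>l k. (k, l) \<in> E \<Longrightarrow> \<bar>\<kappa> l k\<bar> < 1 / (2 * real CARD('n))"
  defines "G \<equiv> (\<chi> l k. of_delay (if (k, l) \<in> E then [:0, \<kappa> l k:] else 0))"
  assumes inv: "invertible (mat 1 - G)"
    and y: "\<And>k. k \<in> measured_nodes C \<Longrightarrow> y $ k = 0"
    and supp: "\<And>k. k \<notin> E `` {i} \<Longrightarrow> ((mat 1 - G) *v y) $ k = 0"
    and yj: "((mat 1 - G) *v y) $ j \<noteq> 0"
  shows "\<exists>G'. network_matrix G' \<and> consistent E G' \<and>
    C ** matrix_inv (mat 1 - G) = C ** matrix_inv (mat 1 - G') \<and> G $ j $ i \<noteq> G' $ j $ i"
proof -
  define d where "d = (mat 1 - G) *v y"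
  obtain b q where q: "b \<noteq> 0" "\<And>l. of_delay b * d $ l = of_delay (q l)" "\<And>l. coeff (q l) 0 = 0"
    by (rule common_delay_denominator[of d]) blast
  have q0: "q l = 0" if "l \<notin> E `` {i}" for l
    using q(2)[of l] supp[OF that] by (simp add: d_def)
  have qj: "q j \<noteq> 0"
    using q(1) q(2)[of j] yj by (auto simp: d_def)
  have "\<exists>K>0. \<forall>u. norm u \<le> 1 \<longrightarrow> norm (poly (map_poly complex_of_real (q l)) u) < K" for l
    by (meson complex_poly_bounded_unit_disc)
  then obtain K where K: "\<And>l. K l > 0"
      "\<And>l u. norm u \<le> 1 \<Longrightarrow> norm (poly (map_poly complex_of_real (q l)) u) < K l"
    by metis
  define K' where "K' = (\<Sum>l\<in>UNIV. K l)"
  have KK': "K l \<le> K'" for l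
    unfolding K'_def using K(1) by (intro member_le_sum) (auto intro: less_imp_le)
  then have "K' > 0"
    using K(1) by (meson less_le_trans)
  \<comment> \<open>With this choice \<open>\<epsilon> * K'\<close> is half of the bound 1/n, for n
    nodes, in \<open>network_matrix_of_delay\<close>; the gains \<open>\<kappa>\<close> take the
    other half.\<close>
  define \<epsilon> where "\<epsilon> = 1 / (2 * real CARD('n) * K')"
  have "\<epsilon> > 0" using \<open>K' > 0\<close> by (simp add: \<epsilon>_def)
  define R :: "real poly^'n^'n" where "R = (\<chi> l k. (if (k, l) \<in> E then [:0, \<kappa> l k:] else 0) +
      (if k = i then smult \<epsilon> (q l) else 0))"
  define G' where "G' = (\<chi> l k. of_delay (R $ l $ k))"
  define c where "c = of_delay [:\<epsilon>:] * of_delay b"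
  have G': "G' $ l $ k = G $ l $ k + (if k = i then c * d $ l else 0)" for l k
  proof -
    have "of_delay (smult \<epsilon> (q l)) = c * d $ l"
      using of_delay_mult[of "[:\<epsilon>:]" "q l"] q(2)[of l] by (simp add: c_def mult.assoc)
    then show ?thesis
      by (simp add: G'_def R_def G_def of_delay_add)
  qed
  have "network_matrix G'"
    unfolding G'_def
  proof (rule network_matrix_of_delay)
    have noloop: "(k, k) \<notin> E" for k
      using \<open>irrefl E\<close> by (simp add: irrefl_def)
    show "R $ k $ k = 0" for k
      using noloop q0[of k] by (auto simp: R_def)
    show "coeff (R $ l $ k) 0 = 0" for l k
      using q(3) by (simp add: R_def)
    fix l k and u :: complex assume u: "norm u \<le> 1"
    let ?p = "\<lambda>f. poly (map_poly complex_of_real f) u"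
    have hom: "?p (f + g) = ?p f + ?p g" "?p (f * g) = ?p f * ?p g" for f g
      by (rule poly_map_poly_hom; simp)+
    have "norm (?p (if (k, l) \<in> E then [:0, \<kappa> l k:] else 0)) < 1 / (2 * real CARD('n))"
    proof (cases "(k, l) \<in> E")
      case True
      have "norm (?p [:0, \<kappa> l k:]) = norm u * \<bar>\<kappa> l k\<bar>"
        by (simp add: map_poly_pCons norm_mult)
      also have "\<dots> \<le> \<bar>\<kappa> l k\<bar>"
        using u by (simp add: mult_left_le_one_le)
      finally show ?thesis using small[OF True] True by simp
    qed simp
    moreover have "norm (?p (if k = i then smult \<epsilon> (q l) else 0)) \<le> 1 / (2 * real CARD('n))"
    proof (cases "k = i")
      case True
      have "norm (?p (smult \<epsilon> (q l))) = \<epsilon> * norm (?p (q l))"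
        using hom(2)[of "[:\<epsilon>:]" "q l"] \<open>\<epsilon> > 0\<close> by (simp add: map_poly_pCons norm_mult)
      also have "\<dots> \<le> \<epsilon> * K'"
        using K(2)[OF u, of l] KK'[of l] \<open>\<epsilon> > 0\<close> by (intro mult_left_mono) auto
      also have "\<dots> = 1 / (2 * real CARD('n))"
        using \<open>K' > 0\<close> by (simp add: \<epsilon>_def)
      finally show ?thesis using True by simp
    qed simp
    ultimately have "norm (?p (R $ l $ k)) < 1 / (2 * real CARD('n)) + 1 / (2 * real CARD('n))"
      unfolding R_def vec_lambda_beta hom by (meson add_less_le_mono norm_triangle_ineq le_less_trans)
    then show "norm (?p (R $ l $ k)) < 1 / real CARD('n)" by simp
  qed
  moreover have "consistent E G'"
    unfolding consistent_def
  proof (intro allI impI, rule ccontr)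
    fix l k assume "G' $ l $ k \<noteq> 0" "(k, l) \<notin> E"
    then show False using q0[of l] by (simp add: G'_def R_def split: if_splits)
  qed
  moreover have "C ** matrix_inv (mat 1 - G) = C ** matrix_inv (mat 1 - G')"
  proof -
    obtain s where s: "range s = measured_nodes C" "\<And>r k. C $ r $ k = (if k = s r then 1 else 0)"
      using selection_matrix_eq[OF C] by blast
    \<comment> \<open>\<open>Y\<close> puts the scaled invisible signal into column
      \<open>i\<close>, so that I - G' = (I - G)(I - Y) and C Y = 0; these two facts make
      \<open>G'\<close> indistinguishable from \<open>G\<close>.\<close>
    define Y :: "transfer^'n^'n" where "Y = (\<chi> l k. if k = i then c * y $ l else 0)"
    have "C ** (mat 1 - Y) = C"
      using y s(1) by (auto simp: vec_eq_iff selection_matrix_mult[where s = s, OF s(2)] s(2) Y_def mat_def)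
    moreover have "(mat 1 - G) ** (mat 1 - Y) = mat 1 - G'"
    proof -
      have "((mat 1 - G) ** Y) $ l $ k = G' $ l $ k - G $ l $ k" for l k
        unfolding G' d_def
        by (simp add: matrix_matrix_mult_def Y_def matrix_vector_mult_def sum_distrib_left mult.left_commute)
      moreover have "(mat 1 - G) ** (mat 1 - Y) = (mat 1 - G) ** mat 1 - (mat 1 - G) ** Y"
        by (simp add: matrix_matrix_mult_def vec_eq_iff right_diff_distrib sum_subtractf del: vector_minus_component)
          (simp add: matrix_matrix_mult_def vec_eq_iff right_diff_distrib sum_subtractf)
      ultimately show ?thesis
        by (simp add: vec_eq_iff)
    qed
    ultimately have "C ** matrix_inv (mat 1 - G) ** (mat 1 - G') = C"
      using matrix_inv_inverse(2)[OF inv] by (metis matrix_mul_assoc matrix_mul_rid)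
    moreover have "invertible (mat 1 - G')"
      using \<open>network_matrix G'\<close> by (simp add: network_matrix_def well_posed_def)
    ultimately show ?thesis
      using matrix_inv_inverse(1) by (metis matrix_mul_assoc matrix_mul_rid)
  qed
  moreover have "G $ j $ i \<noteq> G' $ j $ i"
    using qj q(2)[of j] \<open>\<epsilon> > 0\<close> q(1) by (auto simp: G' c_def)
  ultimately show ?thesis by blast
qed

text \<open>One parametrization is enough to refute: a gain with one delay on each edge. If the path
  count does not drop, column \<open>j\<close> generically depends on columns of other
  out-neighbours, and for gains in a small box this dependence yields a second network. Uniqueness
  then fails at almost every point of a box of positive measure.\<close>

lemma generically_identifiable_only_if:
  fixes E :: "('n::finite \<times> 'n) set" and C :: "transfer^'n^'p::finite"
  assumes "irrefl E" "selection_matrix C" "(i, j) \<in> E"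
    and ident: "generically_identifiable E C i j"
  shows "max_disjoint_paths E (E `` {i}) (measured_nodes C) =
    max_disjoint_paths E (E `` {i} - {j}) (measured_nodes C) + 1"
proof (rule ccontr)
  let ?N = "E `` {i}" and ?B = "measured_nodes C"
  let ?G = "parametrized_matrix E (\<lambda>_ _. 1) (\<lambda>_ _. 0)"
  let ?I = "parameters E (\<lambda>_ _. 0)"
  define \<delta> where "\<delta> = 1 / (2 * real CARD('n))"
  have "\<delta> > 0" by (simp add: \<delta>_def)
  assume "\<not> ?thesis"
  then have le: "max_disjoint_paths E ?N ?B \<le> max_disjoint_paths E (?N - {j}) ?B"
    using max_disjoint_paths_le_remove[of E ?N ?B j] by simp
  obtain S where S: "disjoint_path_family E (?N - {j}) ?B S"
      "card S = max_disjoint_paths E (?N - {j}) ?B"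
    by (rule ex_max_disjoint_path_family)
  define A where "A = hd ` S"
  have A: "A \<subseteq> ?N - {j}" "card A = max_disjoint_paths E (?N - {j}) ?B"
    using S card_image[OF inj_on_hd_disjoint_path_family[OF S(1)]] disjoint_path_familyD(3)[OF S(1)]
    by (auto simp: A_def)
  have "disjoint_path_family E {} {} {}"
    by (simp add: disjoint_path_family_def)
  from AE_observable[OF this, where n = "\<lambda>_ _. 0" and p = "\<lambda>_ _. 1"] AE_observable[OF S(1), where n = "\<lambda>_ _. 0" and p = "\<lambda>_ _. 1"]
    ident[unfolded generically_identifiable_def, THEN spec, THEN spec,
      of "\<lambda>_ _. 1" "\<lambda>_ _. 0"]
  have "AE P in Pi\<^sub>M ?I (\<lambda>_. lborel). P \<notin> Pi\<^sub>E ?I (\<lambda>_. {- \<delta><..<\<delta>})"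
  proof eventually_elim
    fix P
    assume empty: "observable (?G P) (hd ` {}) {}" and obs: "observable (?G P) (hd ` S) ?B"
      and unique: "\<forall>G'. network_matrix G' \<longrightarrow> consistent E G' \<longrightarrow>
          C ** matrix_inv (mat 1 - ?G P) = C ** matrix_inv (mat 1 - G') \<longrightarrow> ?G P $ j $ i = G' $ j $ i"
    show "P \<notin> Pi\<^sub>E ?I (\<lambda>_. {- \<delta><..<\<delta>})"
    proof
      assume box: "P \<in> Pi\<^sub>E ?I (\<lambda>_. {- \<delta><..<\<delta>})"
      \<comment> \<open>\<open>A\<close> has at least as many nodes as there are disjoint paths from
        all out-neighbours, so adding \<open>j\<close> exceeds the upper bound.\<close>
      have "\<not> observable (?G P) (insert j A) ?B"
      proof
        assume "observable (?G P) (insert j A) ?B"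
        then have "card (insert j A) \<le> max_disjoint_paths E ?N ?B"
          using A(1) \<open>(i, j) \<in> E\<close>
          by (intro card_le_max_disjoint_paths_of_observable[OF consistent_parametrized_matrix]) auto
        moreover have "card (insert j A) = card A + 1"
          using A(1) by (subst card_insert_disjoint) auto
        ultimately show False using A(2) le by simp
      qed
      then obtain y where y: "\<And>k. k \<in> ?B \<Longrightarrow> y $ k = 0"
          "\<And>k. k \<notin> insert j A \<Longrightarrow> ((mat 1 - ?G P) *v y) $ k = 0" "y \<noteq> 0"
        unfolding observable_def by blast
      \<comment> \<open>Without excitation at \<open>j\<close> the signal would be excited from the
        observable set \<open>A\<close> alone.\<close>
      have yj: "((mat 1 - ?G P) *v y) $ j \<noteq> 0"
      proof
        assume "((mat 1 - ?G P) *v y) $ j = 0"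
        then have "((mat 1 - ?G P) *v y) $ k = 0" if "k \<notin> A" for k
          using y(2)[of k] that by (cases "k = j") auto
        then have "y = 0"
          using observableD[OF obs, folded A_def] y(1) by blast
        with y(3) show False ..
      qed
      have G: "?G P = (\<chi> l k. of_delay (if (k, l) \<in> E then [:0, P (Kappa l k):] else 0))"
        by (simp add: vec_eq_iff parametrized_matrix_def monic_poly_def of_delay_pCons monom_Suc
            Zero_fract_def eq_fract)
      have "\<exists>G'. network_matrix G' \<and> consistent E G' \<and>
          C ** matrix_inv (mat 1 - ?G P) = C ** matrix_inv (mat 1 - G') \<and> ?G P $ j $ i \<noteq> G' $ j $ i"
      proof (rule ex_indistinguishable_network[OF assms(1,2), where y = y
            and \<kappa> = "\<lambda>l k. P (Kappa l k)", folded G])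
        show "\<bar>P (Kappa l k)\<bar> < 1 / (2 * real CARD('n))" if "(k, l) \<in> E" for l k
        proof -
          have "Kappa l k \<in> ?I" using that by (auto simp: parameters_def)
          then have "P (Kappa l k) \<in> {- \<delta><..<\<delta>}" using box by (rule PiE_mem[rotated])
          then show ?thesis by (auto simp: \<delta>_def)
        qed
        show "invertible (mat 1 - ?G P)"
          using empty by (auto intro: invertible_of_observable)
        show "((mat 1 - ?G P) *v y) $ k = 0" if "k \<notin> ?N" for k
          using that A(1) \<open>(i, j) \<in> E\<close> by (intro y(2)) auto
      qed (use y(1) yj in auto)
      then show False using unique by blast
    qed
  qed
  then show False
    using not_AE_not_in_box[OF finite_parameters \<open>\<delta> > 0\<close>] by blast
qed

theorem theoremV2:
  fixes E :: "('n::finite \<times> 'n) set"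
    and G0 :: "transfer^'n^'n"
    and C :: "transfer^'n^'p::finite"
    and i j :: 'n
  assumes "irrefl E"
    and "weakly_connected E"
    and "network_matrix G0"
    and "consistent E G0"
    and "selection_matrix C"
    and "(i, j) \<in> E"
  shows "generically_identifiable E C i j \<longleftrightarrow>
    max_disjoint_paths E (E `` {i}) (measured_nodes C) =
      max_disjoint_paths E (E `` {i} - {j}) (measured_nodes C) + 1"
  using generically_identifiable_if[OF assms(5)]
    generically_identifiable_only_if[OF assms(1,5,6)] by blast

end
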